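(* Let $n$ be a positive integer. Let $\Omega\subseteq\mathbb{R}^{n}$ be a periodic set such that $\partial\Omega$ is a $C^{\infty}$ manifold, and let $B\subseteq\mathbb{R}^{n}$ be a periodic half space. Then the following (sharp) inequality holds: $$\int_{[-\frac12,\frac12]^{n}\cap\partial\Omega}dx\;\geq\;\int_{[-\frac12,\frac12]^{n}\cap\partial B}dx+\int_{[-\frac12,\frac12]^{n}\cap\partial\Omega}\Big(1-\frac{\|N(x)\|_{1}}{\sqrt{n}}\Big)dx.$$
   Context: A subset $\Omega\subseteq\mathbb{R}^{n}$ is called periodic if $\Omega+v=\Omega^{c}$ for every standard basis vector $v\in\mathbb{R}^{n}$, and $-\Omega=\Omega^{c}$ (up to changes to $\Omega$ of Lebesgue measure zero). A periodic half space is any set of the form $B=\{x=(x_1,\ldots,x_n)\in\mathbb{R}^{n}\colon \sin(\pi(\epsilon_{1}x_{1}+\cdots+\epsilon_{n}x_{n}))\geq 0\}$ with $\epsilon_{1},\ldots,\epsilon_{n}\in\{-1,1\}$. In integrals over (subsets of) $\partial\Omega$ and $\partial B$, $dx$ denotes Lebesgue (surface) measure restricted to the surface. A $C^{\infty}$ manifold is locally the graph of a $C^{\infty}$ function. For $x\in\partial\Omega$, $N(x)$ is the exterior normal vector at $x$ with $\|N(x)\|_{2}=1$. For $q\geq 1$, $\|x\|_{q}^{q}=|x_{1}|^{q}+\cdots+|x_{n}|^{q}$. *)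

theory Defs
  imports "HOL-Analysis.Analysis"
begin

section \<open>Periodic sets and periodic half spaces\<close>

definition periodic_set :: "(real ^ 'n) set \<Rightarrow> bool" where
  "periodic_set \<Omega> \<longleftrightarrow>
     (\<forall>i. negligible (sym_diff ((\<lambda>x. x + axis i 1) ` \<Omega>) (- \<Omega>))) \<and>
     negligible (sym_diff (uminus ` \<Omega>) (- \<Omega>))"

definition periodic_half_space :: "(real ^ 'n) set \<Rightarrow> bool" where
  "periodic_half_space B \<longleftrightarrow>
     (\<exists>\<epsilon> :: real ^ 'n. (\<forall>i. \<epsilon> $ i \<in> {-1, 1}) \<and>
        B = {x. sin (pi * (\<Sum>i\<in>UNIV. \<epsilon> $ i * x $ i)) \<ge> 0})"

definition unit_cube :: "(real ^ 'n) set" where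
  "unit_cube = {x. \<forall>i. x $ i \<in> {-1/2..1/2}}"

definition l1_norm :: "real ^ 'n \<Rightarrow> real" where
  "l1_norm v = (\<Sum>i\<in>UNIV. \<bar>v $ i\<bar>)"

section \<open>Smooth hypersurfaces\<close>

definition partial_deriv :: "'n \<Rightarrow> (real ^ 'n \<Rightarrow> real) \<Rightarrow> real ^ 'n \<Rightarrow> real" where
  "partial_deriv j f x = frechet_derivative f (at x) (axis j 1)"

primrec Ck_on :: "nat \<Rightarrow> (real ^ 'n \<Rightarrow> real) \<Rightarrow> (real ^ 'n) set \<Rightarrow> bool" where
  "Ck_on 0 f U \<longleftrightarrow> continuous_on U f"
| "Ck_on (Suc k) f U \<longleftrightarrow> f differentiable_on U \<and> (\<forall>j. Ck_on k (partial_deriv j f) U)"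

text \<open>Only used for open \<open>U\<close>.\<close>

definition smooth_on :: "(real ^ 'n \<Rightarrow> real) \<Rightarrow> (real ^ 'n) set \<Rightarrow> bool" where
  "smooth_on f U \<longleftrightarrow> (\<forall>k. Ck_on k f U)"

definition set_coord :: "'n \<Rightarrow> real \<Rightarrow> real ^ 'n \<Rightarrow> real ^ 'n" where
  "set_coord i t x = (\<chi> j. if j = i then t else x $ j)"

definition cylinder :: "'n \<Rightarrow> (real ^ 'n) set \<Rightarrow> (real ^ 'n) set" where
  "cylinder i U = {x. \<exists>t. set_coord i t x \<in> U}"

text \<open>
  Inside the open set \<open>U\<close>, the set \<open>S\<close> is the graph \<open>x\<^sub>i = g(x\<^sub>j : j \<noteq> i)\<close> of a
  \<open>C\<^sup>\<infinity>\<close> function on the projection of \<open>U\<close> along the \<open>i\<close>-th axis. A function of the \<open>n - 1\<close>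
  coordinates other than \<open>x\<^sub>i\<close> is encoded as a function on the cylinder over that projection
  that does not depend on \<open>x\<^sub>i\<close>.
\<close>

definition graph_chart ::
    "(real ^ 'n) set \<Rightarrow> 'n \<Rightarrow> (real ^ 'n) set \<Rightarrow> (real ^ 'n \<Rightarrow> real) \<Rightarrow> bool" where
  "graph_chart S i U g \<longleftrightarrow>
     open U \<and> smooth_on g (cylinder i U) \<and>
     (\<forall>x\<in>cylinder i U. \<forall>t. g (set_coord i t x) = g x) \<and>
     S \<inter> U = {x \<in> U. x $ i = g x}"

definition smooth_hypersurface :: "(real ^ 'n) set \<Rightarrow> bool" where
  "smooth_hypersurface S \<longleftrightarrow> (\<forall>x\<in>S. \<exists>i U g. x \<in> U \<and> graph_chart S i U g)"

section \<open>Surface measure\<close>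

text \<open>\<open>(n - 1)\<close>-dimensional Lebesgue measure on the coordinate hyperplane \<open>x\<^sub>i = 0\<close>
  (for \<open>n = 1\<close>: the unit mass at the origin).\<close>

definition hyperplane_measure :: "'n \<Rightarrow> (real ^ 'n) measure" where
  "hyperplane_measure i =
     distr (\<Pi>\<^sub>M j\<in>UNIV - {i}. lborel) borel (\<lambda>y. \<chi> j. if j = i then 0 else y j)"

text \<open>The area element \<open>sqrt (1 + |\<nabla>g|\<^sup>2)\<close> integrated over the parameters of the graph points
  in \<open>A\<close>. The \<open>i\<close>-th partial derivative of \<open>g\<close> vanishes in a chart.\<close>

definition graph_area :: "'n \<Rightarrow> (real ^ 'n \<Rightarrow> real) \<Rightarrow> (real ^ 'n) set \<Rightarrow> ennreal" where
  "graph_area i g A =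
     (\<integral>\<^sup>+ y. ennreal (sqrt (1 + (\<Sum>j\<in>UNIV. (partial_deriv j g y)\<^sup>2))) *
             indicator A (set_coord i (g y) y) \<partial>hyperplane_measure i)"

definition is_surface_measure :: "(real ^ 'n) set \<Rightarrow> (real ^ 'n) measure \<Rightarrow> bool" where
  "is_surface_measure S M \<longleftrightarrow>
     sets M = sets borel \<and> emeasure M (- S) = 0 \<and>
     (\<forall>i U g. graph_chart S i U g \<longrightarrow>
        (\<forall>A\<in>sets borel. A \<subseteq> S \<inter> U \<longrightarrow> emeasure M A = graph_area i g A))"

text \<open>For a closed smooth hypersurface there is exactly one such measure: charts cover it, and
  graph areas in overlapping charts agree by change of variables.\<close>

definition surface_measure :: "(real ^ 'n) set \<Rightarrow> (real ^ 'n) measure" where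
  "surface_measure S = (THE M. is_surface_measure S M)"

text \<open>Surface integral over the part of the hypersurface \<open>S\<close> in the unit cube.\<close>

definition cube_surface_integral :: "(real ^ 'n) set \<Rightarrow> (real ^ 'n \<Rightarrow> real) \<Rightarrow> real" where
  "cube_surface_integral S f = (LINT x:unit_cube \<inter> S|surface_measure S. f x)"

section \<open>Exterior normal\<close>

definition tangent_vectors :: "(real ^ 'n) set \<Rightarrow> real ^ 'n \<Rightarrow> (real ^ 'n) set" where
  "tangent_vectors S x =
     {v. \<exists>c. (\<forall>t. c t \<in> S) \<and> c 0 = x \<and> (c has_vector_derivative v) (at 0)}"

definition is_unit_normal :: "(real ^ 'n) set \<Rightarrow> real ^ 'n \<Rightarrow> real ^ 'n \<Rightarrow> bool" where
  "is_unit_normal S x v \<longleftrightarrow> norm v = 1 \<and> (\<forall>w\<in>tangent_vectors S x. v \<bullet> w = 0)"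

definition is_exterior_normal :: "(real ^ 'n) set \<Rightarrow> real ^ 'n \<Rightarrow> real ^ 'n \<Rightarrow> bool" where
  "is_exterior_normal \<Omega> x v \<longleftrightarrow>
     is_unit_normal (frontier \<Omega>) x v \<and>
     (\<forall>\<^sub>F t in at_right 0. x + t *\<^sub>R v \<notin> \<Omega> \<and> x - t *\<^sub>R v \<in> \<Omega>)"

text \<open>
  Smoothness of the frontier does not by itself exclude points with \<open>\<Omega>\<close> (or its complement) on
  both sides, such as a slit, where no exterior normal exists; there any unit normal is taken.
\<close>

definition exterior_normal :: "(real ^ 'n) set \<Rightarrow> real ^ 'n \<Rightarrow> real ^ 'n" where
  "exterior_normal \<Omega> x =
     (if \<exists>v. is_exterior_normal \<Omega> x v then (THE v. is_exterior_normal \<Omega> x v)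
      else (SOME v. is_unit_normal (frontier \<Omega>) x v))"

end

theory Submission
  imports Defs
begin

text \<open>
  The claim is equivalent to \<open>\<integral> \<parallel>N\<parallel>\<^sub>1 \<ge> n\<close>, the integral being taken over the part of \<open>\<partial>\<Omega>\<close> in the
  unit cube, because the part of \<open>\<partial>B\<close> in the cube has area \<open>sqrt n\<close>. It suffices to show
  \<open>\<integral> \<bar>N\<^sub>j\<bar> \<ge> 1\<close> for each coordinate \<open>j\<close>, and this is a projection argument. A segment of length \<open>1\<close>
  in direction \<open>j\<close> joins a point to its translate by a basis vector; if it missed \<open>\<partial>\<Omega>\<close>, both
  endpoints would lie in the interior of \<open>\<Omega>\<close>, or both in the interior of its complement, and
  \<open>\<Omega> + e\<^sub>j = \<Omega>\<^sup>c\<close> would fail on an open set. So every line in direction \<open>j\<close> through the cube meets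
  \<open>\<partial>\<Omega>\<close> inside the cube (\<open>unit_segment_meets_frontier\<close>), and the projection of
  \<open>\<partial>\<Omega> \<inter> [-1/2, 1/2]\<^sup>n\<close> along \<open>e\<^sub>j\<close> has measure \<open>1\<close>. On the other hand \<open>\<bar>N\<^sub>j\<bar>\<close> is the Jacobian of that
  projection, so the integral of \<open>\<bar>N\<^sub>j\<bar>\<close> over a piece of surface is at least the measure of its shadow
  (\<open>projection_le_chart_integral\<close>). For a periodic half space almost every point of the shadow is
  covered exactly once and all \<open>\<bar>N\<^sub>j\<bar>\<close> equal \<open>1 / sqrt n\<close>, which gives both the area \<open>sqrt n\<close> and the sharpness:
  \<open>\<Omega> = B\<close> is a case of equality.

  Most of the work is the surface measure, which is defined by a definite description and is
  therefore usable only once it exists and is unique. The point is that areas computed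
  in two charts agree (\<open>chart_integral_area_eq\<close>). The projection inequality yields this as well: applied
  to one chart over the hyperplane of the other, it compares the two parameter measures up to the
  Jacobian, which is exactly the quotient of the area elements because the unit normal is unique
  up to sign. This gives one inequality between the areas, and the other one by symmetry.

  Integrals over the hyperplane \<open>x\<^sub>i = 0\<close> are replaced throughout by integrals over the slab
  \<open>0 \<le> x\<^sub>i \<le> 1\<close> of \<open>\<real>\<^sup>n\<close> of functions independent of \<open>x\<^sub>i\<close>. Charts over different hyperplanes then
  live on the same space with the same measure, and the projection inequality becomes the bound
  \<open>\<lambda>(G ` W) \<le> \<integral>\<^sub>W \<bar>det DG\<bar>\<close> for a differentiable self-map \<open>G\<close> of \<open>\<real>\<^sup>n\<close>, valid at critical
  points and for maps that are not injective alike.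
\<close>

section \<open>Lebesgue measure under relabelling of coordinates\<close>

lemma prod_Basis_cart: "(\<Prod>b\<in>Basis. f (b :: real ^ 'n)) = (\<Prod>i\<in>UNIV. f (axis i 1))"
proof -
  have "inj (\<lambda>i. axis i (1::real) :: real ^ 'n)"
    by (auto simp: inj_on_def axis_eq_axis)
  then show ?thesis
    using prod.reindex[of "\<lambda>i. axis i (1::real) :: real ^ 'n" UNIV f]
    by (simp add: Basis_vec_def o_def UNION_singleton_eq_range)
qed

definition permute_coords :: "('m \<Rightarrow> 'n) \<Rightarrow> real ^ 'n \<Rightarrow> real ^ 'm" where
  "permute_coords \<sigma> x = (\<chi> k. x $ \<sigma> k)"

lemma permute_coords_nth [simp]: "permute_coords \<sigma> x $ k = x $ \<sigma> k"
  by (simp add: permute_coords_def)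

lemma bounded_linear_permute_coords: "bounded_linear (permute_coords \<sigma>)"
  by (rule linear_conv_bounded_linear[THEN iffD1])
     (auto intro!: linearI simp: vec_eq_iff)

lemma continuous_on_permute_coords [continuous_intros]:
  "continuous_on A f \<Longrightarrow> continuous_on A (\<lambda>x. permute_coords \<sigma> (f x))"
  by (rule bounded_linear.continuous_on[OF bounded_linear_permute_coords])

lemma measurable_permute_coords [measurable]: "permute_coords \<sigma> \<in> borel_measurable borel"
  by (intro borel_measurable_continuous_onI continuous_on_permute_coords continuous_on_id)

lemma lborel_distr_permute_coords:
  fixes \<sigma> :: "'m::finite \<Rightarrow> 'n::finite"
  assumes "bij \<sigma>"
  shows "distr lborel borel (permute_coords \<sigma>) = lborel"
proof (rule lborel_eqI[symmetric])
  fix l u :: "real ^ 'm" assume le: "\<And>b. b \<in> Basis \<Longrightarrow> l \<bullet> b \<le> u \<bullet> b"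
  let ?\<tau> = "inv \<sigma>"
  have le': "l $ i \<le> u $ i" for i
    using le[of "axis i 1"] by (auto simp: Basis_vec_def inner_axis)
  have \<tau>: "\<sigma> (?\<tau> k) = k" "?\<tau> (\<sigma> m) = m" for k m
    using assms by (simp_all add: bij_is_surj surj_f_inv_f bij_is_inj)
  have "permute_coords \<sigma> -` box l u = box (permute_coords ?\<tau> l) (permute_coords ?\<tau> u)"
  proof (intro set_eqI)
    fix x
    have "(\<forall>k. l $ k < x $ \<sigma> k \<and> x $ \<sigma> k < u $ k) \<longleftrightarrow> (\<forall>k. l $ ?\<tau> k < x $ k \<and> x $ k < u $ ?\<tau> k)"
      by (metis \<tau>)
    then show "x \<in> permute_coords \<sigma> -` box l u \<longleftrightarrow> x \<in> box (permute_coords ?\<tau> l) (permute_coords ?\<tau> u)"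
      by (simp add: mem_box_cart)
  qed
  then have "emeasure (distr lborel borel (permute_coords \<sigma>)) (box l u)
      = emeasure lborel (box (permute_coords ?\<tau> l) (permute_coords ?\<tau> u))"
    by (subst emeasure_distr) auto
  also have "\<dots> = (\<Prod>i\<in>UNIV. (u - l) $ ?\<tau> i)"
    using le' by (subst emeasure_lborel_box) (force simp: Basis_vec_def inner_axis, simp add: prod_Basis_cart inner_axis)
  also have "(\<Prod>i\<in>UNIV. (u - l) $ ?\<tau> i) = (\<Prod>i\<in>UNIV. (u - l) $ i)"
    by (rule prod.reindex_bij_betw[of ?\<tau> UNIV UNIV "\<lambda>i. (u - l) $ i"]) (simp add: assms bij_imp_bij_inv)
  finally show "emeasure (distr lborel borel (permute_coords \<sigma>)) (box l u) = (\<Prod>b\<in>Basis. (u - l) \<bullet> b)"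
    by (simp add: prod_Basis_cart inner_axis)
qed simp

lemma emeasure_lborel_permute_coords:
  fixes \<sigma> :: "'m::finite \<Rightarrow> 'n::finite"
  assumes "bij \<sigma>" "E \<in> sets borel"
  shows "emeasure lborel (permute_coords \<sigma> -` E) = emeasure lborel E"
proof -
  have "emeasure lborel E = emeasure (distr lborel borel (permute_coords \<sigma>)) E"
    by (simp only: lborel_distr_permute_coords[OF assms(1)])
  also have "\<dots> = emeasure lborel (permute_coords \<sigma> -` E)"
    by (subst emeasure_distr) (use assms in auto)
  finally show ?thesis ..
qed

lemma nn_integral_lborel_permute_coords:
  fixes \<sigma> :: "'m::finite \<Rightarrow> 'n::finite"
  assumes "bij \<sigma>" "f \<in> borel_measurable borel"
  shows "(\<integral>\<^sup>+ x. f (permute_coords \<sigma> x) \<partial>lborel) = (\<integral>\<^sup>+ x. f x \<partial>lborel)"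
proof -
  have "(\<integral>\<^sup>+ x. f x \<partial>lborel) = (\<integral>\<^sup>+ x. f x \<partial>distr lborel borel (permute_coords \<sigma>))"
    by (simp only: lborel_distr_permute_coords[OF assms(1)])
  also have "\<dots> = (\<integral>\<^sup>+ x. f (permute_coords \<sigma> x) \<partial>lborel)"
    by (subst nn_integral_distr) (use assms in auto)
  finally show ?thesis ..
qed

section \<open>Replacing one coordinate by a function\<close>

lemma set_coord_nth [simp]: "set_coord i t x $ k = (if k = i then t else x $ k)"
  by (simp add: set_coord_def)

lemma set_coord_eq: "set_coord i t x = x + (t - x $ i) *\<^sub>R axis i 1"
  by (auto simp: vec_eq_iff axis_def)

lemma set_coord_set_coord [simp]: "set_coord i s (set_coord i t x) = set_coord i s x"
  by (simp add: vec_eq_iff)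

lemma set_coord_triv [simp]: "set_coord i (x $ i) x = x"
  by (simp add: vec_eq_iff)

lemma has_derivative_set_coord:
  fixes g :: "real ^ 'n \<Rightarrow> real"
  assumes "(g has_derivative g') (at x within W)"
  shows "((\<lambda>x. set_coord j (g x) x) has_derivative (\<lambda>v. set_coord j (g' v) v)) (at x within W)"
proof -
  have "((\<lambda>x. x + (g x - x $ j) *\<^sub>R axis j 1) has_derivative
      (\<lambda>v. v + (g' v - v $ j) *\<^sub>R axis j 1)) (at x within W)"
    by (auto intro!: derivative_eq_intros assms bounded_linear.has_derivative[OF bounded_linear_vec_nth]
        simp: fun_eq_iff)
  then show ?thesis by (simp add: set_coord_eq)
qed

lemma det_set_coord:
  fixes g' :: "real ^ 'n \<Rightarrow> real"
  assumes "linear g'"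
  shows "det (matrix (\<lambda>v. set_coord j (g' v) v)) = g' (axis j 1)"
proof -
  let ?a = "\<chi> k. g' (axis k 1) :: real ^ 'n"
  have "matrix (\<lambda>v. set_coord j (g' v) v)
      = (\<chi> i. if i = j then \<Sum>k\<in>UNIV. ?a $ k *s row k (mat 1) else row i (mat 1))"
    by (auto simp: matrix_def vec_eq_iff row_def mat_def axis_def if_distrib cong: if_cong)
  then show ?thesis
    using cramer_lemma_transpose[of j ?a "mat 1"] by simp
qed

text \<open>
  The map changes only the \<open>j\<close>-th coordinate, so its Jacobian determinant is \<open>\<partial>\<^sub>j g\<close>. The image
  may fail to be a Borel set; a Borel superset of the same measure serves all later purposes.
\<close>

lemma emeasure_image_set_coord_le_wellorder:
  fixes g :: "real ^ 'n::{finite,wellorder} \<Rightarrow> real"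
  assumes W: "W \<in> sets borel"
    and der: "\<And>x. x \<in> W \<Longrightarrow> (g has_derivative g' x) (at x)"
    and meas: "(\<lambda>x. g' x (axis j 1) * indicator W x) \<in> borel_measurable borel"
  shows "\<exists>E\<in>sets borel. (\<lambda>x. set_coord j (g x) x) ` W \<subseteq> E \<and>
           emeasure lborel E \<le> (\<integral>\<^sup>+x. ennreal \<bar>g' x (axis j 1)\<bar> * indicator W x \<partial>lborel)"
proof (cases "(\<integral>\<^sup>+x. ennreal \<bar>g' x (axis j 1)\<bar> * indicator W x \<partial>lborel) = \<infinity>")
  case True
  then show ?thesis by (intro bexI[of _ UNIV]) auto
next
  case False
  define F where "F = (\<lambda>x. set_coord j (g x) x)"
  define D where "D = (\<lambda>x. \<bar>g' x (axis j 1)\<bar> * indicator W x)"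
  have nnD: "(\<integral>\<^sup>+x. ennreal \<bar>g' x (axis j 1)\<bar> * indicator W x \<partial>lborel) = (\<integral>\<^sup>+x. ennreal (D x) \<partial>lborel)"
    by (intro nn_integral_cong) (auto simp: D_def indicator_def)
  have "D = (\<lambda>x. \<bar>g' x (axis j 1) * indicator W x\<bar>)"
    by (auto simp: D_def indicator_def)
  with meas have D_meas: "D \<in> borel_measurable borel" by simp
  have D_nn: "D x \<ge> 0" for x by (auto simp: D_def indicator_def)
  have "(\<integral>\<^sup>+x. ennreal (D x) \<partial>lborel) < \<infinity>" using False nnD by (simp add: top.not_eq_extremum)
  then obtain r where r: "(\<integral>\<^sup>+x. ennreal (D x) \<partial>lborel) = ennreal r" "r \<ge> 0"
    by (cases "(\<integral>\<^sup>+x. ennreal (D x) \<partial>lborel)") auto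
  then have "(D has_integral r) UNIV"
    using D_meas D_nn by (intro nn_integral_has_integral) auto
  moreover have "D = (\<lambda>x. if x \<in> W then \<bar>g' x (axis j 1)\<bar> else 0)"
    by (auto simp: D_def)
  ultimately have "((\<lambda>x. \<bar>g' x (axis j 1)\<bar>) has_integral r) W"
    by (simp add: has_integral_restrict_UNIV)
  moreover have det: "det (matrix (\<lambda>v. set_coord j (g' x v) v)) = g' x (axis j 1)" if "x \<in> W" for x
    using der[OF that] det_set_coord has_derivative_linear by blast
  ultimately have int: "((\<lambda>x. \<bar>det (matrix (\<lambda>v. set_coord j (g' x v) v))\<bar>) has_integral r) W"
    by (subst has_integral_cong[where g = "\<lambda>x. \<bar>g' x (axis j 1)\<bar>"]) auto
  have derF: "(F has_derivative (\<lambda>v. set_coord j (g' x v) v)) (at x within W)" if "x \<in> W" for x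
    unfolding F_def using der[OF that] by (intro has_derivative_set_coord) (rule has_derivative_at_withinI)
  have Wl: "W \<in> sets lebesgue" using W by simp
  have im: "F ` W \<in> lmeasurable"
    using measurable_differentiable_image[OF Wl derF] int by blast
  have le: "measure lebesgue (F ` W) \<le> r"
    using measure_differentiable_image[OF Wl derF has_integral_integrable[OF int]]
    by (simp only: integral_unique[OF int])
  obtain E where E: "E \<in> sets lborel" "F ` W \<subseteq> E" "emeasure lborel E = emeasure lebesgue (F ` W)"
    using im by (metis emeasure_completion completion_upper fmeasurableD main_part_sets)
  have "emeasure lebesgue (F ` W) \<le> ennreal r"
    using le im by (simp add: emeasure_eq_measure2 ennreal_leI)
  with E show ?thesis
    by (intro bexI[of _ E]) (auto simp: nnD r F_def)
qed

text \<open>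
  Carries the previous bound from well-ordered index types to arbitrary finite ones: the copy is ordered
  through an injection into the natural numbers, and relabelling coordinates preserves Lebesgue
  measure.
\<close>

typedef 'a ordered_copy = "UNIV :: 'a set" ..

instance ordered_copy :: (finite) finite
proof
  have "inj (Rep_ordered_copy :: 'a ordered_copy \<Rightarrow> 'a)" by (simp add: inj_on_def Rep_ordered_copy_inject)
  then show "finite (UNIV :: 'a ordered_copy set)" by (rule finite_imageD[rotated]) simp
qed

instantiation ordered_copy :: (finite) wellorder
begin

definition less_eq_ordered_copy :: "'a ordered_copy \<Rightarrow> 'a ordered_copy \<Rightarrow> bool" where
  "less_eq_ordered_copy x y \<longleftrightarrow> to_nat (Rep_ordered_copy x) \<le> to_nat (Rep_ordered_copy y)"

definition less_ordered_copy :: "'a ordered_copy \<Rightarrow> 'a ordered_copy \<Rightarrow> bool" where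
  "less_ordered_copy x y \<longleftrightarrow> to_nat (Rep_ordered_copy x) < to_nat (Rep_ordered_copy y)"

instance
proof
  fix P and a :: "'a ordered_copy"
  assume step: "\<And>x :: 'a ordered_copy. (\<And>y. y < x \<Longrightarrow> P y) \<Longrightarrow> P x"
  show "P a"
    by (induction a rule: measure_induct_rule[of "\<lambda>x. to_nat (Rep_ordered_copy x)"])
       (auto intro: step simp: less_ordered_copy_def)
qed (auto simp: less_eq_ordered_copy_def less_ordered_copy_def Rep_ordered_copy_inject)

end

lemma bij_ordered_copy: "bij (Rep_ordered_copy :: 'a ordered_copy \<Rightarrow> 'a)" "bij (Abs_ordered_copy :: 'a \<Rightarrow> 'a ordered_copy)"
  by (metis Abs_ordered_copy_inverse Rep_ordered_copy_inverse UNIV_I bijI')+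

lemma emeasure_image_set_coord_le:
  fixes g :: "real ^ 'n \<Rightarrow> real"
  assumes W: "W \<in> sets borel"
    and der: "\<And>x. x \<in> W \<Longrightarrow> (g has_derivative g' x) (at x)"
    and meas: "(\<lambda>x. g' x (axis j 1) * indicator W x) \<in> borel_measurable borel"
  shows "\<exists>E\<in>sets borel. (\<lambda>x. set_coord j (g x) x) ` W \<subseteq> E \<and>
           emeasure lborel E \<le> (\<integral>\<^sup>+x. ennreal \<bar>g' x (axis j 1)\<bar> * indicator W x \<partial>lborel)"
proof -
  let ?R = "permute_coords (Rep_ordered_copy :: 'n ordered_copy \<Rightarrow> 'n)"
  let ?A = "permute_coords (Abs_ordered_copy :: 'n \<Rightarrow> 'n ordered_copy)"
  have AR [simp]: "?A (?R x) = x" "?R (?A y) = y" for x y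
    by (simp_all add: vec_eq_iff Abs_ordered_copy_inverse Rep_ordered_copy_inverse)
  have A_axis: "?A (axis (Abs_ordered_copy j) 1) = axis j 1"
    by (auto simp: vec_eq_iff axis_def Abs_ordered_copy_inject)
  define W' where "W' = ?A -` W"
  define h where "h = (\<lambda>y. g (?A y))"
  define h' where "h' = (\<lambda>y v. g' (?A y) (?A v))"
  have W': "W' \<in> sets borel"
    unfolding W'_def using W by (metis measurable_permute_coords measurable_sets_borel)
  have "\<exists>E\<in>sets borel. (\<lambda>y. set_coord (Abs_ordered_copy j) (h y) y) ` W' \<subseteq> E \<and>
      emeasure lborel E \<le> (\<integral>\<^sup>+y. ennreal \<bar>h' y (axis (Abs_ordered_copy j) 1)\<bar> * indicator W' y \<partial>lborel)"
  proof (rule emeasure_image_set_coord_le_wellorder[OF W'])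
    fix y assume "y \<in> W'"
    then have "(g has_derivative g' (?A y)) (at (?A y))" by (auto simp: W'_def intro: der)
    moreover have "(?A has_derivative ?A) (at y)"
      by (intro bounded_linear.has_derivative[OF bounded_linear_permute_coords] has_derivative_ident)
    ultimately show "(h has_derivative h' y) (at y)"
      unfolding h_def h'_def by (rule has_derivative_compose[rotated])
  next
    have "(\<lambda>y. h' y (axis (Abs_ordered_copy j) 1) * indicator W' y)
        = (\<lambda>x. g' x (axis j 1) * indicator W x) \<circ> ?A"
      by (auto simp: h'_def A_axis W'_def indicator_def fun_eq_iff)
    then show "(\<lambda>y. h' y (axis (Abs_ordered_copy j) 1) * indicator W' y) \<in> borel_measurable borel"
      using measurable_comp[OF measurable_permute_coords meas] by simp
  qed
  then obtain E' where E': "E' \<in> sets borel" "(\<lambda>y. set_coord (Abs_ordered_copy j) (h y) y) ` W' \<subseteq> E'"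
      "emeasure lborel E' \<le> (\<integral>\<^sup>+y. ennreal \<bar>h' y (axis (Abs_ordered_copy j) 1)\<bar> * indicator W' y \<partial>lborel)"
    by blast
  have "(\<integral>\<^sup>+y. ennreal \<bar>h' y (axis (Abs_ordered_copy j) 1)\<bar> * indicator W' y \<partial>lborel)
      = (\<integral>\<^sup>+y. ennreal (\<bar>g' (?A y) (axis j 1) * indicator W (?A y)\<bar>) \<partial>lborel)"
    by (intro nn_integral_cong) (auto simp: h'_def A_axis W'_def indicator_def)
  also have "\<dots> = (\<integral>\<^sup>+x. ennreal (\<bar>g' x (axis j 1) * indicator W x\<bar>) \<partial>lborel)"
    using meas by (subst nn_integral_lborel_permute_coords[OF bij_ordered_copy(2), symmetric]) auto
  also have "\<dots> = (\<integral>\<^sup>+x. ennreal \<bar>g' x (axis j 1)\<bar> * indicator W x \<partial>lborel)"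
    by (intro nn_integral_cong) (auto simp: indicator_def)
  finally have int: "emeasure lborel (?R -` E') \<le> (\<integral>\<^sup>+x. ennreal \<bar>g' x (axis j 1)\<bar> * indicator W x \<partial>lborel)"
    using E'(3) emeasure_lborel_permute_coords[OF bij_ordered_copy(1) E'(1)] by simp
  have "?R (set_coord j (g x) x) \<in> E'" if "x \<in> W" for x
  proof -
    have "?R (set_coord j (g x) x) = set_coord (Abs_ordered_copy j) (h (?R x)) (?R x)"
      by (auto simp: vec_eq_iff h_def Abs_ordered_copy_inverse Rep_ordered_copy_inverse)
    moreover have "?R x \<in> W'" using that by (simp add: W'_def)
    ultimately show ?thesis using E'(2) by auto
  qed
  moreover have "?R -` E' \<in> sets borel"
    using E'(1) by (metis measurable_permute_coords measurable_sets_borel)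
  ultimately show ?thesis
    using int by (intro bexI[of _ "?R -` E'"]) auto
qed

section \<open>Charts\<close>

lemma set_coord_in_cylinder [simp]: "set_coord i t x \<in> cylinder i U \<longleftrightarrow> x \<in> cylinder i U"
  by (simp add: cylinder_def)

lemma set_coord_in_cylinderI: "set_coord i t x \<in> U \<Longrightarrow> x \<in> cylinder i U"
  by (auto simp: cylinder_def)

lemma subset_cylinder: "x \<in> U \<Longrightarrow> x \<in> cylinder i U"
  unfolding cylinder_def by (auto intro!: exI[of _ "x $ i"])

lemma continuous_on_set_coord [continuous_intros]:
  assumes "continuous_on A f" "continuous_on A g"
  shows "continuous_on A (\<lambda>x. set_coord i (g x) (f x))"
  unfolding set_coord_eq by (intro continuous_intros assms)

lemma open_cylinder: "open U \<Longrightarrow> open (cylinder i U)"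
proof -
  assume "open U"
  then have "open ((\<lambda>x. set_coord i t x) -` U)" for t
    by (intro open_vimage continuous_intros)
  moreover have "cylinder i U = (\<Union>t. (\<lambda>x. set_coord i t x) -` U)"
    by (auto simp: cylinder_def)
  ultimately show ?thesis by auto
qed

text \<open>
  The gradient of \<open>x\<^sub>i - g x\<close>, hence normal to the graph; its length is the area element.
\<close>

definition chart_normal :: "'n \<Rightarrow> (real ^ 'n \<Rightarrow> real) \<Rightarrow> real ^ 'n \<Rightarrow> real ^ 'n" where
  "chart_normal i g x = axis i 1 - (\<chi> k. partial_deriv k g x)"

lemma graph_chartD:
  assumes "graph_chart S i U g"
  shows "open U" "open (cylinder i U)" "continuous_on (cylinder i U) g"
    and "\<And>x. x \<in> cylinder i U \<Longrightarrow> (g has_derivative frechet_derivative g (at x)) (at x)"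
    and "\<And>k. continuous_on (cylinder i U) (partial_deriv k g)"
    and "\<And>x t. x \<in> cylinder i U \<Longrightarrow> g (set_coord i t x) = g x"
    and "\<And>x. x \<in> U \<Longrightarrow> x \<in> S \<longleftrightarrow> x $ i = g x"
proof -
  show o: "open U" "open (cylinder i U)"
    using assms by (auto simp: graph_chart_def open_cylinder)
  have "Ck_on (Suc 0) g (cylinder i U)"
    using assms unfolding graph_chart_def smooth_on_def by blast
  then have d: "g differentiable_on cylinder i U"
    and "\<And>k. continuous_on (cylinder i U) (partial_deriv k g)" by simp_all
  then show "continuous_on (cylinder i U) g" "\<And>k. continuous_on (cylinder i U) (partial_deriv k g)"
    by (auto intro: differentiable_imp_continuous_on)
  show "(g has_derivative frechet_derivative g (at x)) (at x)" if "x \<in> cylinder i U" for x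
    using d that o by (simp add: differentiable_on_eq_differentiable_at frechet_derivative_works)
  show "g (set_coord i t x) = g x" if "x \<in> cylinder i U" for x t
    using assms that unfolding graph_chart_def by blast
  show "x \<in> S \<longleftrightarrow> x $ i = g x" if "x \<in> U" for x
    using assms that unfolding graph_chart_def by blast
qed

lemma frechet_derivative_partial:
  fixes g :: "real ^ 'n \<Rightarrow> real"
  assumes "(g has_derivative frechet_derivative g (at x)) (at x)"
  shows "frechet_derivative g (at x) v = (\<Sum>k\<in>UNIV. partial_deriv k g x * v $ k)"
proof -
  let ?D = "frechet_derivative g (at x)"
  have lin: "linear ?D" using assms has_derivative_linear by blast
  have "?D v = ?D (\<Sum>k\<in>UNIV. v $ k *\<^sub>R axis k 1)"
    by (rule arg_cong[of _ _ ?D]) (simp add: vec_eq_iff axis_def if_distrib cong: if_cong)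
  also have "\<dots> = (\<Sum>k\<in>UNIV. v $ k *\<^sub>R ?D (axis k 1))"
    by (simp add: linear_sum[OF lin] linear_scale[OF lin])
  finally show ?thesis by (simp add: partial_deriv_def mult.commute)
qed

text \<open>
  Data of a chart depend only on the coordinates other than \<open>x\<^sub>i\<close>, so they may be evaluated
  at a parameter point or at the surface point above it.
\<close>

lemma chart_partial_deriv_set_coord:
  assumes ch: "graph_chart S i U g" and x: "x \<in> cylinder i U"
  shows "partial_deriv k g (set_coord i t x) = partial_deriv k g x"
proof -
  define e where "e = (t - x $ i) *\<^sub>R (axis i 1 :: real ^ 'a)"
  let ?D = "frechet_derivative g (at (set_coord i t x))"
  have sc: "y + e = set_coord i (y $ i + (t - x $ i)) y" for y
    by (simp add: set_coord_eq e_def)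
  have "set_coord i t x = x + e" by (simp add: set_coord_eq e_def)
  then have "(g has_derivative ?D) (at (x + e))"
    using graph_chartD(4)[OF ch] x by (metis set_coord_in_cylinder)
  moreover have "((\<lambda>y. y + e) has_derivative (\<lambda>v. v)) (at x)"
    by (auto intro!: derivative_eq_intros)
  ultimately have "((\<lambda>y. g (y + e)) has_derivative ?D) (at x)"
    using has_derivative_compose by blast
  then have "(g has_derivative ?D) (at x)"
    by (rule has_derivative_transform_within_open[OF _ graph_chartD(2)[OF ch] x])
       (simp add: sc graph_chartD(6)[OF ch])
  then show ?thesis
    unfolding partial_deriv_def by (metis frechet_derivative_at)
qed

lemma chart_partial_deriv_self:
  assumes ch: "graph_chart S i U g" and x: "x \<in> cylinder i U"
  shows "partial_deriv i g x = 0"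
proof -
  let ?D = "frechet_derivative g (at x)"
  have "(g has_derivative ?D) (at (set_coord i (x $ i) x))"
    using graph_chartD(4)[OF ch x] by simp
  moreover have "((\<lambda>s. set_coord i s x) has_derivative (\<lambda>s. s *\<^sub>R axis i 1)) (at (x $ i))"
    unfolding set_coord_eq by (auto intro!: derivative_eq_intros simp: fun_eq_iff)
  ultimately have "((\<lambda>s. g (set_coord i s x)) has_derivative (\<lambda>s. ?D (s *\<^sub>R axis i 1))) (at (x $ i))"
    by (rule has_derivative_compose[rotated])
  then have "((\<lambda>s. g x) has_derivative (\<lambda>s. ?D (s *\<^sub>R axis i 1))) (at (x $ i))"
    by (simp add: graph_chartD(6)[OF ch x])
  then have "(\<lambda>s. ?D (s *\<^sub>R axis i 1)) = (\<lambda>s. 0)"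
    using has_derivative_const has_derivative_unique by blast
  from fun_cong[OF this, of 1] show ?thesis by (simp add: partial_deriv_def)
qed

lemma chart_normal_self: "graph_chart S i U g \<Longrightarrow> x \<in> cylinder i U \<Longrightarrow> chart_normal i g x $ i = 1"
  by (simp add: chart_normal_def chart_partial_deriv_self)

lemma chart_normal_other: "k \<noteq> i \<Longrightarrow> chart_normal i g x $ k = - partial_deriv k g x"
  by (simp add: chart_normal_def axis_def)

lemma chart_normal_set_coord:
  "graph_chart S i U g \<Longrightarrow> x \<in> cylinder i U \<Longrightarrow> chart_normal i g (set_coord i t x) = chart_normal i g x"
  by (simp add: chart_normal_def chart_partial_deriv_set_coord)

lemma norm_chart_normal:
  assumes ch: "graph_chart S i U g" and x: "x \<in> cylinder i U"
  shows "norm (chart_normal i g x) = sqrt (1 + (\<Sum>k\<in>UNIV. (partial_deriv k g x)\<^sup>2))"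
proof -
  have "(chart_normal i g x $ k)\<^sup>2 = (axis i 1 $ k) + (partial_deriv k g x)\<^sup>2" for k
    using chart_partial_deriv_self[OF ch x] by (auto simp: chart_normal_def axis_def)
  then have "(\<Sum>k\<in>UNIV. (chart_normal i g x $ k)\<^sup>2) = 1 + (\<Sum>k\<in>UNIV. (partial_deriv k g x)\<^sup>2)"
    by (simp add: sum.distrib axis_def)
  then show ?thesis by (simp add: norm_vec_def L2_set_def)
qed

lemma norm_chart_normal_pos:
  assumes "graph_chart S i U g" "x \<in> cylinder i U"
  shows "norm (chart_normal i g x) > 0"
  using chart_normal_self[OF assms] by auto

lemma continuous_on_chart_normal:
  assumes "graph_chart S i U g"
  shows "continuous_on (cylinder i U) (chart_normal i g)"
  unfolding chart_normal_def
  by (intro continuous_intros continuous_on_vec_lambda graph_chartD(5)[OF assms])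

lemma frechet_chart:
  assumes ch: "graph_chart S i U g" and x: "x \<in> cylinder i U"
  shows "frechet_derivative g (at x) v = v $ i - chart_normal i g x \<bullet> v"
proof -
  have "chart_normal i g x \<bullet> v = axis i 1 \<bullet> v - (\<Sum>k\<in>UNIV. partial_deriv k g x * v $ k)"
    by (simp add: chart_normal_def inner_diff_left) (simp add: inner_vec_def)
  then show ?thesis
    using frechet_derivative_partial[OF graph_chartD(4)[OF ch x]] by (simp add: inner_axis')
qed

section \<open>Integration over a coordinate hyperplane\<close>

definition slab :: "'n \<Rightarrow> (real ^ 'n) set" where
  "slab i = {x. 0 \<le> x $ i \<and> x $ i \<le> 1}"

lemma measurable_slab [measurable]: "slab i \<in> sets borel"
  unfolding slab_def
  by (intro borel_closed closed_Collect_conj closed_Collect_le continuous_intros)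

lemma sets_hyperplane_measure [measurable_cong, simp]: "sets (hyperplane_measure i) = sets borel"
  by (simp add: hyperplane_measure_def)

lemma measurable_vec_component [measurable]: "(\<lambda>x :: real ^ 'n. x $ k) \<in> borel_measurable borel"
  by (intro borel_measurable_continuous_onI continuous_intros)

lemma borel_measurable_cartI:
  fixes f :: "'a \<Rightarrow> real ^ 'n"
  assumes "\<And>k. (\<lambda>x. f x $ k) \<in> borel_measurable M"
  shows "f \<in> borel_measurable M"
  using assms by (subst borel_measurable_euclidean_space) (auto simp: Basis_vec_def inner_axis)

text \<open>
  Fubini for one coordinate against the others. For \<open>n = 1\<close> the product over the remaining
  coordinates is empty and the hyperplane carries a unit mass.
\<close>

lemma lborel_hyperplane:
  "distr (hyperplane_measure i \<Otimes>\<^sub>M lborel) borel (\<lambda>(y, t). set_coord i t y) = (lborel :: (real ^ 'n) measure)"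
    (is "distr ?M borel ?f = _")
proof (rule lborel_eqI[symmetric])
  have f[measurable]: "?f \<in> ?M \<rightarrow>\<^sub>M borel"
    by (rule borel_measurable_cartI) (simp add: case_prod_beta)
  interpret product_sigma_finite "\<lambda>k::'n. lborel :: real measure" ..
  let ?J = "UNIV - {i}"
  let ?h = "\<lambda>y. (\<chi> j. if j = i then 0 else y j) :: real ^ 'n"
  have h[measurable]: "?h \<in> (\<Pi>\<^sub>M j\<in>?J. lborel) \<rightarrow>\<^sub>M borel"
  proof (rule borel_measurable_cartI)
    fix k
    show "(\<lambda>x. ?h x $ k) \<in> borel_measurable (\<Pi>\<^sub>M j\<in>?J. lborel)"
      by (cases "k = i") auto
  qed
  fix l u :: "real ^ 'n" assume le: "\<And>b. b \<in> Basis \<Longrightarrow> l \<bullet> b \<le> u \<bullet> b"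
  have le': "l $ k \<le> u $ k" for k
    using le[of "axis k 1"] by (auto simp: Basis_vec_def inner_axis)
  define A :: "(real ^ 'n) set" where "A = {y. \<forall>k\<in>?J. l $ k < y $ k \<and> y $ k < u $ k}"
  have A[measurable]: "A \<in> sets borel"
    unfolding A_def by measurable
  have "?h -` A \<inter> space (\<Pi>\<^sub>M j\<in>?J. lborel) = (\<Pi>\<^sub>E k\<in>?J. {l $ k <..< u $ k})"
    by (auto simp: A_def space_PiM PiE_def Pi_def)
  then have "emeasure (hyperplane_measure i) A = (\<Prod>k\<in>?J. emeasure lborel {l $ k <..< u $ k})"
    unfolding hyperplane_measure_def by (simp add: emeasure_distr emeasure_PiM)
  also have "\<dots> = (\<Prod>k\<in>?J. ennreal (u $ k - l $ k))"
    using le' by simp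
  finally have eA: "emeasure (hyperplane_measure i) A = ennreal (\<Prod>k\<in>?J. u $ k - l $ k)"
    using le' by (simp add: prod_ennreal)
  have "set_coord i t y \<in> box l u \<longleftrightarrow> y \<in> A \<and> t \<in> {l $ i <..< u $ i}" for t y
    by (auto simp: A_def mem_box_cart)
  then have "?f -` box l u \<inter> space ?M = A \<times> {l $ i <..< u $ i}"
    by (auto simp: space_pair_measure hyperplane_measure_def)
  then have "emeasure (distr ?M borel ?f) (box l u) = emeasure ?M (A \<times> {l $ i <..< u $ i})"
    by (simp add: emeasure_distr)
  also have "\<dots> = emeasure (hyperplane_measure i) A * emeasure lborel {l $ i <..< u $ i}"
    by (intro lborel.emeasure_pair_measure_Times) auto
  also have "\<dots> = ennreal ((u $ i - l $ i) * (\<Prod>k\<in>?J. u $ k - l $ k))"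
    using le' by (simp add: eA ennreal_mult prod_nonneg mult.commute)
  also have "(u $ i - l $ i) * (\<Prod>k\<in>?J. u $ k - l $ k) = (\<Prod>k\<in>UNIV. u $ k - l $ k)"
    by (subst prod.remove[of UNIV i]) auto
  finally show "emeasure (distr ?M borel ?f) (box l u) = (\<Prod>b\<in>Basis. (u - l) \<bullet> b)"
    by (simp add: prod_Basis_cart inner_axis)
qed simp

lemma nn_integral_hyperplane_measure:
  fixes F :: "real ^ 'n \<Rightarrow> ennreal"
  assumes F[measurable]: "F \<in> borel_measurable borel" and inv: "\<And>x t. F (set_coord i t x) = F x"
  shows "(\<integral>\<^sup>+y. F y \<partial>hyperplane_measure i) = (\<integral>\<^sup>+x. F x * indicator (slab i) x \<partial>lborel)"
proof -
  let ?M = "hyperplane_measure i \<Otimes>\<^sub>M (lborel :: real measure)"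
  have f[measurable]: "(\<lambda>(y, t). set_coord i t y) \<in> ?M \<rightarrow>\<^sub>M borel"
    by (rule borel_measurable_cartI) (simp add: case_prod_beta)
  have "(\<integral>\<^sup>+x. F x * indicator (slab i) x \<partial>lborel)
      = (\<integral>\<^sup>+x. F x * indicator (slab i) x \<partial>distr ?M borel (\<lambda>(y, t). set_coord i t y))"
    by (simp add: lborel_hyperplane)
  also have "\<dots> = (\<integral>\<^sup>+z. F (fst z) * indicator {0..1} (snd z) \<partial>?M)"
    by (subst nn_integral_distr)
       (auto simp: case_prod_beta inv slab_def indicator_def intro!: nn_integral_cong)
  also have "\<dots> = (\<integral>\<^sup>+y. \<integral>\<^sup>+t. F y * indicator {0..1} (t :: real) \<partial>lborel \<partial>hyperplane_measure i)"
    by (subst lborel.nn_integral_fst[symmetric]) auto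
  also have "\<dots> = (\<integral>\<^sup>+y. F y \<partial>hyperplane_measure i)"
    by (simp add: nn_integral_cmult)
  finally show ?thesis ..
qed

section \<open>Integrals over pieces of a chart\<close>

text \<open>
  The integral of \<open>f\<close> over the part of the graph in \<open>A\<close> with respect to Lebesgue measure of the
  parameter hyperplane, without the area element.
\<close>

definition chart_integral ::
    "'n \<Rightarrow> (real ^ 'n \<Rightarrow> real) \<Rightarrow> (real ^ 'n) set \<Rightarrow> (real ^ 'n \<Rightarrow> ennreal) \<Rightarrow> ennreal" where
  "chart_integral i g A f =
     (\<integral>\<^sup>+x. f (set_coord i (g x) x) * indicator A (set_coord i (g x) x) * indicator (slab i) x \<partial>lborel)"

text \<open>
  Nothing is known about \<open>g\<close> outside the cylinder, so the parametrisation of the graph is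
  cut off there before measurability can be claimed.
\<close>

lemma chart_lift_measurable:
  assumes ch: "graph_chart S i U g"
  obtains P where "P \<in> borel \<rightarrow>\<^sub>M borel" "\<And>x. x \<in> cylinder i U \<Longrightarrow> P x = set_coord i (g x) x"
proof
  let ?P = "\<lambda>x. indicator (cylinder i U) x *\<^sub>R set_coord i (g x) x"
  show "?P \<in> borel \<rightarrow>\<^sub>M borel"
    using graph_chartD(2,3)[OF ch]
    by (intro borel_measurable_continuous_on_indicator continuous_intros borel_open)
qed simp

lemma chart_lift_vimage [measurable]:
  assumes ch: "graph_chart S i U g" and A: "A \<in> sets borel" "A \<subseteq> U"
  shows "{x. set_coord i (g x) x \<in> A} \<in> sets borel"
proof -
  obtain P where P: "P \<in> borel \<rightarrow>\<^sub>M borel" "\<And>x. x \<in> cylinder i U \<Longrightarrow> P x = set_coord i (g x) x"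
    using chart_lift_measurable[OF ch] by blast
  have "{x. set_coord i (g x) x \<in> A} = cylinder i U \<inter> P -` A"
  proof (intro set_eqI)
    fix x
    have "set_coord i (g x) x \<in> A \<Longrightarrow> x \<in> cylinder i U" using A(2) set_coord_in_cylinderI by blast
    then show "x \<in> {x. set_coord i (g x) x \<in> A} \<longleftrightarrow> x \<in> cylinder i U \<inter> P -` A"
      using P(2)[of x] by auto
  qed
  moreover have "P -` A \<in> sets borel" using measurable_sets_borel[OF P(1) A(1)] .
  moreover have "cylinder i U \<in> sets borel" using graph_chartD(2)[OF ch] by (rule borel_open)
  ultimately show ?thesis by (auto intro: sets.Int)
qed

lemma borel_measurable_norm_chart_normal:
  assumes ch: "graph_chart S i U g"
  shows "(\<lambda>x. ennreal (norm (chart_normal i g x)) * indicator (cylinder i U) x) \<in> borel_measurable borel"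
proof -
  have "(\<lambda>x. indicator (cylinder i U) x *\<^sub>R norm (chart_normal i g x)) \<in> borel_measurable borel"
    using graph_chartD(2)[OF ch] continuous_on_chart_normal[OF ch]
    by (intro borel_measurable_continuous_on_indicator continuous_intros borel_open)
  then have "(\<lambda>x. ennreal (indicator (cylinder i U) x *\<^sub>R norm (chart_normal i g x))) \<in> borel_measurable borel"
    by simp
  moreover have "(\<lambda>x. ennreal (indicator (cylinder i U) x *\<^sub>R norm (chart_normal i g x)))
      = (\<lambda>x. ennreal (norm (chart_normal i g x)) * indicator (cylinder i U) x)"
    by (auto simp: indicator_def)
  ultimately show ?thesis by metis
qed

lemma graph_area_eq_chart_integral:
  assumes ch: "graph_chart S i U g" and A: "A \<in> sets borel" "A \<subseteq> U"
  shows "graph_area i g A = chart_integral i g A (\<lambda>x. ennreal (norm (chart_normal i g x)))"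
proof -
  let ?L = "\<lambda>x. set_coord i (g x) x"
  let ?V = "cylinder i U"
  define F where "F = (\<lambda>x. ennreal (norm (chart_normal i g x)) * indicator ?V x * indicator {x. ?L x \<in> A} x)"
  have F: "F \<in> borel_measurable borel"
    unfolding F_def using borel_measurable_norm_chart_normal[OF ch] chart_lift_vimage[OF ch A] by measurable
  have inA: "x \<in> ?V" if "?L x \<in> A" for x using that A(2) set_coord_in_cylinderI by blast
  have L_inv: "?L (set_coord i t x) = ?L x" if "x \<in> ?V" for x t
    using graph_chartD(6)[OF ch that] by simp
  have inv: "F (set_coord i t x) = F x" for x t
  proof (cases "x \<in> ?V")
    case True
    then show ?thesis using L_inv[OF True] chart_normal_set_coord[OF ch True] by (simp add: F_def indicator_def)
  qed (simp add: F_def)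
  have "graph_area i g A = (\<integral>\<^sup>+y. F y \<partial>hyperplane_measure i)"
    unfolding graph_area_def
  proof (intro nn_integral_cong)
    fix y
    show "ennreal (sqrt (1 + (\<Sum>j\<in>UNIV. (partial_deriv j g y)\<^sup>2))) * indicator A (?L y) = F y"
      using inA[of y] norm_chart_normal[OF ch, of y] by (auto simp: F_def indicator_def)
  qed
  also have "\<dots> = (\<integral>\<^sup>+x. F x * indicator (slab i) x \<partial>lborel)"
    by (rule nn_integral_hyperplane_measure[OF F inv])
  also have "\<dots> = chart_integral i g A (\<lambda>x. ennreal (norm (chart_normal i g x)))"
    unfolding chart_integral_def
  proof (intro nn_integral_cong)
    fix x
    show "F x * indicator (slab i) x
      = ennreal (norm (chart_normal i g (?L x))) * indicator A (?L x) * indicator (slab i) x"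
      using inA[of x] chart_normal_set_coord[OF ch, of x] by (auto simp: F_def indicator_def)
  qed
  finally show ?thesis .
qed

lemma chart_integral_as_measure:
  assumes ch: "graph_chart S i U g" and A: "A \<in> sets borel" "A \<subseteq> U"
  obtains K where "sets K = sets borel"
    "\<And>f. f \<in> borel_measurable borel \<Longrightarrow> (\<integral>\<^sup>+x. f x \<partial>K) = chart_integral i g A f"
proof -
  obtain P where P: "P \<in> borel \<rightarrow>\<^sub>M borel" "\<And>x. x \<in> cylinder i U \<Longrightarrow> P x = set_coord i (g x) x"
    using chart_lift_measurable[OF ch] by blast
  let ?W = "{x. set_coord i (g x) x \<in> A} \<inter> slab i"
  have W: "?W \<in> sets borel" using chart_lift_vimage[OF ch A] by (intro sets.Int) auto
  define K where "K = distr (density lborel (indicator ?W)) borel P"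
  show ?thesis
  proof
    show "sets K = sets borel" by (simp add: K_def)
    fix f :: "real ^ 'a \<Rightarrow> ennreal" assume f: "f \<in> borel_measurable borel"
    have "(\<integral>\<^sup>+x. f x \<partial>K) = (\<integral>\<^sup>+x. indicator ?W x * f (P x) \<partial>lborel)"
      unfolding K_def using P(1) f W by (simp add: nn_integral_distr nn_integral_density)
    also have "\<dots> = chart_integral i g A f"
      unfolding chart_integral_def
    proof (intro nn_integral_cong)
      fix x
      show "indicator ?W x * f (P x) =
        f (set_coord i (g x) x) * indicator A (set_coord i (g x) x) * indicator (slab i) x"
        using P(2)[of x] A(2) set_coord_in_cylinderI[of i "g x" x U] by (auto simp: indicator_def)
    qed
    finally show "(\<integral>\<^sup>+x. f x \<partial>K) = chart_integral i g A f" .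
  qed
qed

lemma chart_integral_cong:
  assumes "\<And>x. x \<in> A \<Longrightarrow> f x = f' x"
  shows "chart_integral i g A f = chart_integral i g A f'"
  unfolding chart_integral_def using assms by (intro nn_integral_cong) (auto simp: indicator_def)

lemma chart_integral_indicator:
  "chart_integral i g A (\<lambda>x. f x * indicator E x) = chart_integral i g (A \<inter> E) f"
  unfolding chart_integral_def by (intro nn_integral_cong) (auto simp: indicator_def)

text \<open>
  The shadow of \<open>A\<close> along \<open>e\<^sub>j\<close> is at most the integral of \<open>\<bar>n\<^sub>j\<bar>\<close>, where \<open>n\<close> is the normal of
  the chart. In the slab picture a parameter point \<open>x\<close> with \<open>j\<close>-th coordinate replaced by
  \<open>g x\<close> is, after exchanging the coordinates \<open>i\<close> and \<open>j\<close>, the shadow of the surface point above \<open>x\<close>;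
  the Jacobian of this map is \<open>\<partial>\<^sub>j g = - n\<^sub>j\<close>. For \<open>j = i\<close> the parameter is the
  shadow, and \<open>n\<^sub>i = 1\<close>.
\<close>

lemma projection_le_chart_integral:
  assumes ch: "graph_chart S i U g" and A: "A \<in> sets borel" "A \<subseteq> S \<inter> U"
  shows "\<exists>E\<in>sets borel. {z \<in> slab j. \<exists>t. set_coord j t z \<in> A} \<subseteq> E \<and>
     emeasure lborel E \<le> chart_integral i g A (\<lambda>x. ennreal \<bar>chart_normal i g x $ j\<bar>)"
proof -
  let ?L = "\<lambda>x. set_coord i (g x) x"
  let ?W = "{x. ?L x \<in> A} \<inter> slab i"
  have AU: "A \<subseteq> U" using A by auto
  have inA: "x \<in> cylinder i U" if "?L x \<in> A" for x using that AU set_coord_in_cylinderI by blast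
  have W: "?W \<in> sets borel" using chart_lift_vimage[OF ch A(1) AU] by (intro sets.Int) auto
  have onS: "p $ i = g p" "p \<in> cylinder i U" if "p \<in> A" for p
  proof -
    from that A(2) have "p \<in> S" "p \<in> U" by auto
    then show "p $ i = g p" "p \<in> cylinder i U" using graph_chartD(7)[OF ch] subset_cylinder by auto
  qed
  show ?thesis
  proof (cases "i = j")
    case True
    have "emeasure lborel ?W = (\<integral>\<^sup>+x. indicator ?W x \<partial>lborel)"
      using W by simp
    also have "\<dots> = chart_integral i g A (\<lambda>x. ennreal \<bar>chart_normal i g x $ j\<bar>)"
      unfolding chart_integral_def
    proof (intro nn_integral_cong)
      fix x
      show "indicator ?W x = ennreal \<bar>chart_normal i g (?L x) $ j\<bar> * indicator A (?L x) * indicator (slab i) x"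
        using inA[of x] chart_normal_self[OF ch, of "?L x"] True by (auto simp: indicator_def)
    qed
    finally have "emeasure lborel ?W = chart_integral i g A (\<lambda>x. ennreal \<bar>chart_normal i g x $ j\<bar>)" .
    moreover have "{z \<in> slab j. \<exists>t. set_coord j t z \<in> A} \<subseteq> ?W"
    proof clarify
      fix z t assume z: "z \<in> slab j" "set_coord j t z \<in> A"
      then have "z \<in> cylinder i U" using AU True set_coord_in_cylinderI by blast
      then have "t = g z" using onS(1)[OF z(2)] True graph_chartD(6)[OF ch, of z t] by simp
      then show "z \<in> ?W" using z True by simp
    qed
    ultimately show ?thesis using W by (intro bexI[of _ ?W]) auto
  next
    case False
    let ?D = "\<lambda>x. frechet_derivative g (at x)"
    have der: "(g has_derivative ?D x) (at x)" if "x \<in> ?W" for x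
      using that inA graph_chartD(4)[OF ch] by blast
    have pd: "?D x (axis j 1) = partial_deriv j g x" for x by (simp add: partial_deriv_def)
    have "(\<lambda>x. indicator (cylinder i U) x *\<^sub>R partial_deriv j g x) \<in> borel_measurable borel"
      using graph_chartD(2,5)[OF ch] by (intro borel_measurable_continuous_on_indicator borel_open)
    then have "(\<lambda>x. indicator (cylinder i U) x *\<^sub>R partial_deriv j g x * indicator ?W x) \<in> borel_measurable borel"
      using W by measurable
    also have "(\<lambda>x. indicator (cylinder i U) x *\<^sub>R partial_deriv j g x * indicator ?W x)
        = (\<lambda>x. ?D x (axis j 1) * indicator ?W x)"
      using inA by (auto simp: fun_eq_iff pd indicator_def)
    finally have meas: "(\<lambda>x. ?D x (axis j 1) * indicator ?W x) \<in> borel_measurable borel" .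
    obtain E where E: "E \<in> sets borel" "(\<lambda>x. set_coord j (g x) x) ` ?W \<subseteq> E"
      "emeasure lborel E \<le> (\<integral>\<^sup>+x. ennreal \<bar>?D x (axis j 1)\<bar> * indicator ?W x \<partial>lborel)"
      using emeasure_image_set_coord_le[OF W der meas] by blast
    let ?\<sigma> = "permute_coords (Transposition.transpose i j) :: real ^ 'a \<Rightarrow> real ^ 'a"
    have "emeasure lborel (?\<sigma> -` E) = emeasure lborel E"
      by (intro emeasure_lborel_permute_coords E involuntory_imp_bij) simp
    also have "\<dots> \<le> (\<integral>\<^sup>+x. ennreal \<bar>?D x (axis j 1)\<bar> * indicator ?W x \<partial>lborel)" by (rule E)
    also have "\<dots> = chart_integral i g A (\<lambda>x. ennreal \<bar>chart_normal i g x $ j\<bar>)"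
      unfolding chart_integral_def
    proof (intro nn_integral_cong)
      fix x
      show "ennreal \<bar>?D x (axis j 1)\<bar> * indicator ?W x
        = ennreal \<bar>chart_normal i g (?L x) $ j\<bar> * indicator A (?L x) * indicator (slab i) x"
        using inA[of x] chart_partial_deriv_set_coord[OF ch, of x j "g x"] False
        by (auto simp: indicator_def pd chart_normal_other)
    qed
    finally have le: "emeasure lborel (?\<sigma> -` E) \<le> chart_integral i g A (\<lambda>x. ennreal \<bar>chart_normal i g x $ j\<bar>)" .
    have "?\<sigma> z \<in> E" if z: "z \<in> slab j" "set_coord j t z \<in> A" for z t
    proof -
      let ?p = "set_coord j t z"
      \<comment> \<open>The free coordinate \<open>z\<^sub>j \<in> [0, 1]\<close> of the shadow becomes the free coordinate \<open>x\<^sub>i\<close> of the parameter.\<close>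
      let ?x = "set_coord i (z $ j) ?p"
      have gx: "g ?x = ?p $ i"
        using onS[OF z(2)] graph_chartD(6)[OF ch] by simp
      have "?x \<in> ?W"
      proof
        have "?L ?x = ?p" unfolding gx set_coord_set_coord by (rule set_coord_triv)
        then show "?x \<in> {x. ?L x \<in> A}" using z by simp
        show "?x \<in> slab i" using z by (simp add: slab_def)
      qed
      then have "set_coord j (g ?x) ?x \<in> E" using E(2) by blast
      moreover have "set_coord j (g ?x) ?x = ?\<sigma> z"
        using False unfolding gx by (auto simp: vec_eq_iff Transposition.transpose_def)
      ultimately show ?thesis by (simp only:)
    qed
    moreover have "?\<sigma> -` E \<in> sets borel" by (rule measurable_sets_borel[OF measurable_permute_coords E(1)])
    ultimately show ?thesis using le by (intro bexI[of _ "?\<sigma> -` E"]) auto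
  qed
qed

section \<open>Tangent and normal vectors\<close>

text \<open>
  Differentiating \<open>x\<^sub>i = g x\<close> along a curve in \<open>S\<close> gives one direction. Conversely, for \<open>w\<close>
  orthogonal to the normal, the line \<open>p + t w\<close> pushed onto the graph has velocity \<open>w\<close>; curves have to stay
  in \<open>S\<close> for all times, so away from \<open>t = 0\<close> the curve is set to \<open>p\<close> where necessary.
\<close>

lemma tangent_vectors_chart:
  assumes ch: "graph_chart S i U g" and p: "p \<in> S" "p \<in> U"
  shows "w \<in> tangent_vectors S p \<longleftrightarrow> chart_normal i g p \<bullet> w = 0"
proof
  let ?D = "frechet_derivative g (at p)"
  note pc = subset_cylinder[OF p(2), of i]
  have lin: "linear ?D" using graph_chartD(4)[OF ch pc] has_derivative_linear by blast
  have gp: "p $ i = g p" using graph_chartD(7)[OF ch p(2)] p(1) by simp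
  show "chart_normal i g p \<bullet> w = 0" if w: "w \<in> tangent_vectors S p"
  proof -
    obtain c where c: "\<And>t. c t \<in> S" "c 0 = p" "(c has_vector_derivative w) (at 0)"
      using w unfolding tangent_vectors_def by auto
    have dc: "(c has_derivative (\<lambda>s. s *\<^sub>R w)) (at 0)"
      using c(3) by (simp add: has_vector_derivative_def)
    have "((\<lambda>t. c t $ i - g (c t)) has_derivative (\<lambda>s. (s *\<^sub>R w) $ i - ?D (s *\<^sub>R w))) (at 0)"
      using graph_chartD(4)[OF ch pc] c(2)
      by (intro has_derivative_diff bounded_linear.has_derivative[OF bounded_linear_vec_nth dc]
          has_derivative_compose[OF dc]) simp
    moreover have "\<forall>\<^sub>F t in at 0. c t $ i - g (c t) = 0"
    proof -
      have "c \<midarrow>0\<rightarrow> p"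
        using has_derivative_continuous[OF dc] c(2) by (simp add: continuous_within)
      then have "\<forall>\<^sub>F t in at 0. c t \<in> U"
        using graph_chartD(1)[OF ch] p(2) by (rule topological_tendstoD)
      then show ?thesis
        by eventually_elim (use c(1) graph_chartD(7)[OF ch] in auto)
    qed
    ultimately have "((\<lambda>t. 0 :: real) has_derivative (\<lambda>s. (s *\<^sub>R w) $ i - ?D (s *\<^sub>R w))) (at 0)"
      by (rule has_derivative_transform_eventually) (simp_all add: c(2) gp)
    then have "(\<lambda>s. (s *\<^sub>R w) $ i - ?D (s *\<^sub>R w)) = (\<lambda>s. 0)"
      using has_derivative_const has_derivative_unique by blast
    from fun_cong[OF this, of 1] show ?thesis
      by (simp add: frechet_chart[OF ch pc])
  qed
  show "w \<in> tangent_vectors S p" if n: "chart_normal i g p \<bullet> w = 0"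
  proof -
    let ?q = "\<lambda>t. p + t *\<^sub>R w"
    let ?r = "\<lambda>t. set_coord i (g (?q t)) (?q t)"
    define c where "c t = (if ?r t \<in> S then ?r t else p)" for t
    have r0: "?r 0 = p" by (simp add: gp[symmetric])
    have "(?q has_derivative (\<lambda>s. s *\<^sub>R w)) (at 0)"
      by (auto intro!: derivative_eq_intros)
    moreover have "((\<lambda>x. set_coord i (g x) x) has_derivative (\<lambda>v. set_coord i (?D v) v)) (at (?q 0))"
      using graph_chartD(4)[OF ch pc] by (intro has_derivative_set_coord) simp
    ultimately have "(?r has_derivative (\<lambda>s. set_coord i (?D (s *\<^sub>R w)) (s *\<^sub>R w))) (at 0)"
      by (rule has_derivative_compose)
    moreover have "set_coord i (?D (s *\<^sub>R w)) (s *\<^sub>R w) = s *\<^sub>R w" for s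
      by (simp add: vec_eq_iff frechet_chart[OF ch pc] n)
    ultimately have dr: "(?r has_derivative (\<lambda>s. s *\<^sub>R w)) (at 0)" by simp
    have "?r \<midarrow>0\<rightarrow> p"
      using has_derivative_continuous[OF dr] r0 by (simp add: continuous_within)
    then have "\<forall>\<^sub>F t in at 0. ?r t \<in> U"
      using graph_chartD(1)[OF ch] p(2) by (rule topological_tendstoD)
    then have "\<forall>\<^sub>F t in at 0. ?r t = c t"
    proof eventually_elim
      case (elim t)
      then have "?q t \<in> cylinder i U" by (rule set_coord_in_cylinderI)
      then have "?r t \<in> S" using graph_chartD(7)[OF ch elim] graph_chartD(6)[OF ch] by simp
      then show ?case by (simp add: c_def)
    qed
    with dr have "(c has_derivative (\<lambda>s. s *\<^sub>R w)) (at 0)"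
      by (rule has_derivative_transform_eventually) (use r0 p in \<open>simp_all add: c_def\<close>)
    moreover have "c t \<in> S" for t using p by (simp add: c_def)
    moreover have "c 0 = p" by (simp add: c_def gp[symmetric])
    ultimately show ?thesis
      unfolding tangent_vectors_def has_vector_derivative_def by blast
  qed
qed

lemma is_unit_normal_chart_normal:
  assumes ch: "graph_chart S i U g" and p: "p \<in> S" "p \<in> U"
  shows "is_unit_normal S p (chart_normal i g p /\<^sub>R norm (chart_normal i g p))"
  unfolding is_unit_normal_def
  using tangent_vectors_chart[OF ch p] norm_chart_normal_pos[OF ch subset_cylinder[OF p(2)]] by auto

text \<open>
  The component of \<open>v\<close> orthogonal to the chart normal is itself a tangent vector, hence
  orthogonal to \<open>v\<close>, hence zero.
\<close>

lemma is_unit_normal_parallel: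
  assumes ch: "graph_chart S i U g" and p: "p \<in> S" "p \<in> U" and v: "is_unit_normal S p v"
  obtains c where "v = c *\<^sub>R chart_normal i g p" "\<bar>c\<bar> * norm (chart_normal i g p) = 1"
proof
  let ?n = "chart_normal i g p"
  let ?c = "(v \<bullet> ?n) / (?n \<bullet> ?n)"
  let ?w = "v - ?c *\<^sub>R ?n"
  have "?n \<noteq> 0" using norm_chart_normal_pos[OF ch subset_cylinder[OF p(2)]] by auto
  then have nw: "?n \<bullet> ?w = 0" by (simp add: inner_diff_right inner_commute)
  then have "v \<bullet> ?w = 0"
    using v tangent_vectors_chart[OF ch p] unfolding is_unit_normal_def by blast
  then have "?w \<bullet> ?w = 0"
    using nw by (simp add: inner_diff_left[of v])
  then show v': "v = ?c *\<^sub>R ?n" by simp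
  have "norm v = 1" using v by (simp add: is_unit_normal_def)
  then show "\<bar>?c\<bar> * norm ?n = 1" using v' by (metis norm_scaleR)
qed

text \<open>
  Only absolute values of the components of a normal enter the theorem, and these do not
  depend on its orientation. The lemma expresses them through any chart.
\<close>

lemma unit_normal_component:
  assumes ch: "graph_chart S i U g" and p: "p \<in> S" "p \<in> U" and v: "is_unit_normal S p v"
  shows "norm (chart_normal i g p) * \<bar>v $ k\<bar> = \<bar>chart_normal i g p $ k\<bar>"
proof -
  obtain c where c: "v = c *\<^sub>R chart_normal i g p" "\<bar>c\<bar> * norm (chart_normal i g p) = 1"
    using is_unit_normal_parallel[OF assms] by blast
  have "norm (chart_normal i g p) * \<bar>v $ k\<bar> = (\<bar>c\<bar> * norm (chart_normal i g p)) * \<bar>chart_normal i g p $ k\<bar>"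
    using c(1) by (simp add: abs_mult)
  then show ?thesis by (simp add: c(2))
qed

text \<open>
  Whichever branch of its definition applies, the exterior normal is a unit normal: two
  distinct exterior normals at a point would be opposite, and then the same points would lie both in \<open>\<Omega>\<close>
  and outside it.
\<close>

lemma is_unit_normal_exterior_normal:
  assumes S: "smooth_hypersurface (frontier \<Omega>)" and p: "p \<in> frontier \<Omega>"
  shows "is_unit_normal (frontier \<Omega>) p (exterior_normal \<Omega> p)"
proof -
  obtain i U g where ch: "graph_chart (frontier \<Omega>) i U g" and pU: "p \<in> U"
    using S p unfolding smooth_hypersurface_def by blast
  show ?thesis
  proof (cases "\<exists>v. is_exterior_normal \<Omega> p v")
    case True
    have "\<exists>!v. is_exterior_normal \<Omega> p v"
    proof (rule ex_ex1I[OF True])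
      fix v w assume vw: "is_exterior_normal \<Omega> p v" "is_exterior_normal \<Omega> p w"
      then have un: "is_unit_normal (frontier \<Omega>) p v" "is_unit_normal (frontier \<Omega>) p w"
        by (auto simp: is_exterior_normal_def)
      let ?n = "chart_normal i g p"
      obtain a b where ab: "v = a *\<^sub>R ?n" "w = b *\<^sub>R ?n" "\<bar>a\<bar> * norm ?n = 1" "\<bar>b\<bar> * norm ?n = 1"
        using is_unit_normal_parallel[OF ch p pU un(1)] is_unit_normal_parallel[OF ch p pU un(2)] by metis
      then have "\<bar>a\<bar> * norm ?n = \<bar>b\<bar> * norm ?n" "norm ?n \<noteq> 0" by auto
      then have "\<bar>a\<bar> = \<bar>b\<bar>" by simp
      then have "w = v \<or> w = - v" using ab by (auto simp: abs_eq_iff)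
      moreover have False if "w = - v"
      proof -
        have "\<forall>\<^sub>F t in at_right (0::real). p + t *\<^sub>R v \<notin> \<Omega>" "\<forall>\<^sub>F t in at_right (0::real). p + t *\<^sub>R v \<in> \<Omega>"
          using vw that by (auto simp: is_exterior_normal_def elim: eventually_mono)
        then have "\<forall>\<^sub>F t in at_right (0::real). False" by eventually_elim simp
        then show False by simp
      qed
      ultimately show "v = w" by blast
    qed
    then have "is_exterior_normal \<Omega> p (exterior_normal \<Omega> p)"
      unfolding exterior_normal_def if_P[OF True] by (rule theI')
    then show ?thesis by (simp add: is_exterior_normal_def)
  next
    case False
    have "\<exists>v. is_unit_normal (frontier \<Omega>) p v"
      using is_unit_normal_chart_normal[OF ch p pU] by blast
    from someI_ex[OF this] show ?thesis using False by (simp add: exterior_normal_def)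
  qed
qed

lemma continuous_on_abs_unit_normal:
  assumes S: "smooth_hypersurface S" and N: "\<And>x. x \<in> S \<Longrightarrow> is_unit_normal S x (N x)"
  shows "continuous_on S (\<lambda>x. \<bar>N x $ k\<bar>)"
  unfolding continuous_on_eq_continuous_within
proof
  fix p assume p: "p \<in> S"
  obtain i U g where ch: "graph_chart S i U g" and pU: "p \<in> U"
    using S p unfolding smooth_hypersurface_def by blast
  let ?f = "\<lambda>x. \<bar>chart_normal i g x $ k\<bar> / norm (chart_normal i g x)"
  have "continuous_on U ?f"
  proof (rule continuous_on_subset)
    show "continuous_on (cylinder i U) ?f"
      using norm_chart_normal_pos[OF ch]
      by (intro continuous_intros continuous_on_chart_normal[OF ch]) force
  qed (auto intro: subset_cylinder)
  then have "continuous (at p within S) ?f"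
    using graph_chartD(1)[OF ch] pU continuous_on_eq_continuous_at continuous_at_imp_continuous_within by blast
  moreover have "\<forall>\<^sub>F x in at p within S. x \<in> U"
    using graph_chartD(1)[OF ch] pU unfolding eventually_at_topological by blast
  then have "\<forall>\<^sub>F x in at p within S. ?f x = \<bar>N x $ k\<bar>"
  proof (rule eventually_elim2)
    show "\<forall>\<^sub>F x in at p within S. x \<in> S" by (simp add: eventually_at_filter)
    fix x assume x: "x \<in> U" "x \<in> S"
    show "?f x = \<bar>N x $ k\<bar>"
      using unit_normal_component[OF ch x(2,1) N[OF x(2)], of k]
        norm_chart_normal_pos[OF ch subset_cylinder[OF x(1)]] by (simp add: field_simps)
  qed
  moreover have "?f p = \<bar>N p $ k\<bar>"
    using unit_normal_component[OF ch p pU N[OF p], of k]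
      norm_chart_normal_pos[OF ch subset_cylinder[OF pU]] by (simp add: field_simps)
  ultimately show "continuous (at p within S) (\<lambda>x. \<bar>N x $ k\<bar>)"
    by (simp add: continuous_within tendsto_cong)
qed

section \<open>Graph areas in overlapping charts\<close>

abbreviation area_element :: "'n \<Rightarrow> (real ^ 'n \<Rightarrow> real) \<Rightarrow> real ^ 'n \<Rightarrow> ennreal" where
  "area_element i g x \<equiv> ennreal (norm (chart_normal i g x))"

text \<open>
  Let \<open>L\<close> and \<open>K\<close> be the parameter measures of the charts \<open>h\<close> and \<open>g\<close>, carried to the surface. Since \<open>h\<close>
  parametrises over the hyperplane \<open>x\<^sub>j = 0\<close>, the measure \<open>L\<close> is the measure of shadows along
  \<open>e\<^sub>j\<close>, so the projection inequality says \<open>L \<le> \<bar>n\<^sub>j\<bar> K\<close> with \<open>n\<close> the normal of \<open>g\<close>. Integrating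
  the area element of \<open>h\<close> and using \<open>\<bar>n\<^sub>j\<bar> = \<parallel>n\<parallel> / \<parallel>m\<parallel>\<close>, where \<open>m\<close> is the normal of \<open>h\<close>, gives the claim.
\<close>

lemma chart_integral_area_le:
  assumes chg: "graph_chart S i U g" and chh: "graph_chart S j V h"
    and A: "A \<in> sets borel" "A \<subseteq> S \<inter> U \<inter> V"
  shows "chart_integral j h A (area_element j h) \<le> chart_integral i g A (area_element i g)"
proof -
  have AU: "A \<subseteq> U" and AV: "A \<subseteq> V" using A by auto
  obtain K where K: "sets K = sets borel"
    "\<And>f. f \<in> borel_measurable borel \<Longrightarrow> (\<integral>\<^sup>+x. f x \<partial>K) = chart_integral i g A f"
    using chart_integral_as_measure[OF chg A(1) AU] by blast
  obtain L where L: "sets L = sets borel"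
    "\<And>f. f \<in> borel_measurable borel \<Longrightarrow> (\<integral>\<^sup>+x. f x \<partial>L) = chart_integral j h A f"
    using chart_integral_as_measure[OF chh A(1) AV] by blast
  define \<psi> where "\<psi> x = ennreal (indicator (cylinder i U) x *\<^sub>R \<bar>chart_normal i g x $ j\<bar>)" for x
  define \<omega> where "\<omega> x = area_element j h x * indicator (cylinder j V) x" for x
  have \<psi>: "\<psi> \<in> borel_measurable borel"
  proof -
    have "(\<lambda>x. indicator (cylinder i U) x *\<^sub>R \<bar>chart_normal i g x $ j\<bar>) \<in> borel_measurable borel"
      using graph_chartD(2)[OF chg] continuous_on_chart_normal[OF chg]
      by (intro borel_measurable_continuous_on_indicator continuous_intros borel_open)
    then show ?thesis unfolding \<psi>_def by simp
  qed
  have \<omega>: "\<omega> \<in> borel_measurable borel"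
    unfolding \<omega>_def by (rule borel_measurable_norm_chart_normal[OF chh])
  have \<psi>A: "\<psi> x = ennreal \<bar>chart_normal i g x $ j\<bar>" if "x \<in> A" for x
    using subset_cylinder[OF subsetD[OF AU that], of i] by (simp add: \<psi>_def)
  have \<omega>A: "\<omega> x = area_element j h x" if "x \<in> A" for x
    using subset_cylinder[OF subsetD[OF AV that], of j] by (simp add: \<omega>_def)
  have "L \<le> density K \<psi>"
  proof (subst le_measure)
    show "sets L = sets (density K \<psi>)" by (simp add: K L)
    show "\<forall>E\<in>sets L. emeasure L E \<le> emeasure (density K \<psi>) E"
    proof
      fix E assume "E \<in> sets L"
      then have E: "E \<in> sets borel" by (simp add: L)
      have AE: "A \<inter> E \<in> sets borel" "A \<inter> E \<subseteq> S \<inter> U" "A \<inter> E \<subseteq> V"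
        using A E by auto
      obtain P where P: "P \<in> sets borel" "{z \<in> slab j. \<exists>t. set_coord j t z \<in> A \<inter> E} \<subseteq> P"
        "emeasure lborel P \<le> chart_integral i g (A \<inter> E) (\<lambda>x. ennreal \<bar>chart_normal i g x $ j\<bar>)"
        using projection_le_chart_integral[OF chg AE(1,2), of j] by blast
      have "emeasure L E = chart_integral j h (A \<inter> E) (\<lambda>x. 1)"
        using L E by (simp flip: nn_integral_indicator chart_integral_indicator)
      also have "\<dots> = (\<integral>\<^sup>+z. indicator ({z. set_coord j (h z) z \<in> A \<inter> E} \<inter> slab j) z \<partial>lborel)"
        unfolding chart_integral_def by (intro nn_integral_cong) (auto simp: indicator_def)
      also have "\<dots> = emeasure lborel ({z. set_coord j (h z) z \<in> A \<inter> E} \<inter> slab j)"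
        using chart_lift_vimage[OF chh AE(1,3)] by (intro nn_integral_indicator) (auto intro!: sets.Int)
      also have "\<dots> \<le> emeasure lborel P"
        using P by (intro emeasure_mono) auto
      also have "\<dots> \<le> chart_integral i g (A \<inter> E) (\<lambda>x. ennreal \<bar>chart_normal i g x $ j\<bar>)" by (rule P)
      also have "\<dots> = chart_integral i g A (\<lambda>x. \<psi> x * indicator E x)"
        unfolding chart_integral_indicator using \<psi>A by (intro chart_integral_cong) auto
      also have "\<dots> = (\<integral>\<^sup>+x. \<psi> x * indicator E x \<partial>K)"
        using \<psi> E by (intro K(2)[symmetric]) auto
      also have "\<dots> = emeasure (density K \<psi>) E"
        using \<psi> E by (subst emeasure_density) (auto simp: K cong: measurable_cong_sets)
      finally show "emeasure L E \<le> emeasure (density K \<psi>) E" .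
    qed
  qed
  then have "(\<integral>\<^sup>+x. \<omega> x \<partial>L) \<le> (\<integral>\<^sup>+x. \<omega> x \<partial>density K \<psi>)"
    by (intro nn_integral_mono_measure) (auto simp: K L)
  also have "\<dots> = (\<integral>\<^sup>+x. \<psi> x * \<omega> x \<partial>K)"
    using \<psi> \<omega> by (intro nn_integral_density) (auto simp: K(1) cong: measurable_cong_sets)
  also have "\<dots> = chart_integral i g A (\<lambda>x. \<psi> x * \<omega> x)"
    using \<psi> \<omega> by (intro K(2)) auto
  also have "\<dots> = chart_integral i g A (area_element i g)"
  proof (rule chart_integral_cong)
    fix x assume x: "x \<in> A"
    then have xS: "x \<in> S" "x \<in> U" "x \<in> V" using A by auto
    let ?v = "chart_normal j h x /\<^sub>R norm (chart_normal j h x)"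
    have v: "is_unit_normal S x ?v" by (rule is_unit_normal_chart_normal[OF chh xS(1,3)])
    have hj: "chart_normal j h x $ j = 1" "norm (chart_normal j h x) > 0"
      using chart_normal_self[OF chh] norm_chart_normal_pos[OF chh] subset_cylinder[OF xS(3)] by auto
    have "\<bar>chart_normal i g x $ j\<bar> * norm (chart_normal j h x) = norm (chart_normal i g x)"
      using unit_normal_component[OF chg xS(1,2) v, of j] hj by (simp add: field_simps)
    then show "\<psi> x * \<omega> x = area_element i g x"
      by (simp add: \<psi>A[OF x] \<omega>A[OF x] flip: ennreal_mult)
  qed
  also have "(\<integral>\<^sup>+x. \<omega> x \<partial>L) = chart_integral j h A (area_element j h)"
    unfolding L(2)[OF \<omega>] using \<omega>A by (rule chart_integral_cong)
  finally show ?thesis .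
qed

lemma chart_integral_area_eq:
  assumes "graph_chart S i U g" "graph_chart S j V h" "A \<in> sets borel" "A \<subseteq> S \<inter> U \<inter> V"
  shows "chart_integral i g A (area_element i g) = chart_integral j h A (area_element j h)"
  using chart_integral_area_le[OF assms(1,2,3)] chart_integral_area_le[OF assms(2,1,3)] assms(4)
  by (intro antisym) auto

section \<open>The surface measure\<close>

lemma chart_area_measure:
  assumes ch: "graph_chart S i U g" and D: "D \<in> sets borel" "D \<subseteq> U"
  obtains \<mu> where "sets \<mu> = sets borel"
    "\<And>f. f \<in> borel_measurable borel \<Longrightarrow>
        (\<integral>\<^sup>+x. f x \<partial>\<mu>) = chart_integral i g D (\<lambda>x. f x * area_element i g x)"
    "\<And>A. A \<in> sets borel \<Longrightarrow> emeasure \<mu> A = chart_integral i g (A \<inter> D) (area_element i g)"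
proof -
  obtain K where K: "sets K = sets borel"
    "\<And>f. f \<in> borel_measurable borel \<Longrightarrow> (\<integral>\<^sup>+x. f x \<partial>K) = chart_integral i g D f"
    using chart_integral_as_measure[OF ch D] by blast
  define \<omega> where "\<omega> x = area_element i g x * indicator (cylinder i U) x" for x
  have \<omega>: "\<omega> \<in> borel_measurable borel"
    unfolding \<omega>_def by (rule borel_measurable_norm_chart_normal[OF ch])
  have \<omega>D: "\<omega> x = area_element i g x" if "x \<in> D" for x
    using subset_cylinder[OF subsetD[OF D(2) that], of i] by (simp add: \<omega>_def)
  let ?\<mu> = "density K \<omega>"
  have s: "sets ?\<mu> = sets borel" by (simp add: K)
  have int: "(\<integral>\<^sup>+x. f x \<partial>?\<mu>) = chart_integral i g D (\<lambda>x. f x * area_element i g x)"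
    if f: "f \<in> borel_measurable borel" for f
  proof -
    have "(\<integral>\<^sup>+x. f x \<partial>?\<mu>) = (\<integral>\<^sup>+x. \<omega> x * f x \<partial>K)"
      using f \<omega> by (intro nn_integral_density) (auto simp: K(1) cong: measurable_cong_sets)
    also have "\<dots> = chart_integral i g D (\<lambda>x. \<omega> x * f x)"
      using f \<omega> by (intro K(2)) auto
    also have "\<dots> = chart_integral i g D (\<lambda>x. f x * area_element i g x)"
      by (rule chart_integral_cong) (simp add: \<omega>D mult.commute)
    finally show ?thesis .
  qed
  have em: "emeasure ?\<mu> A = chart_integral i g (A \<inter> D) (area_element i g)" if A: "A \<in> sets borel" for A
  proof -
    have "emeasure ?\<mu> A = (\<integral>\<^sup>+x. indicator A x \<partial>?\<mu>)" using A s by simp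
    also have "\<dots> = chart_integral i g D (\<lambda>x. indicator A x * area_element i g x)"
      using A by (intro int) auto
    also have "\<dots> = chart_integral i g (A \<inter> D) (area_element i g)"
      by (subst Int_commute, subst chart_integral_indicator[symmetric]) (simp add: mult.commute)
    finally show ?thesis .
  qed
  show ?thesis by (rule that[OF s int em])
qed

text \<open>
  The empty set is a chart domain, which allows an enumeration by all natural numbers even
  if \<open>S\<close> is empty.
\<close>

lemma countable_charts:
  assumes "smooth_hypersurface S"
  obtains I U G where "\<And>k::nat. graph_chart S (I k) (U k) (G k)" "S \<subseteq> (\<Union>k. U k)"
proof -
  let ?F = "{U. \<exists>i g. graph_chart S i U g}"
  have "open V" if "V \<in> ?F" for V using that graph_chartD(1) by auto
  then obtain F where F: "F \<subseteq> ?F" "countable F" "\<Union>F = \<Union>?F"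
    by (rule Lindelof)
  have SF: "S \<subseteq> \<Union>F" unfolding F(3) using assms unfolding smooth_hypersurface_def by blast
  have Ck: "Ck_on k f {}" for k and f :: "real ^ 'a \<Rightarrow> real"
    by (induction k arbitrary: f) (auto simp: differentiable_on_def)
  have "graph_chart S undefined {} (\<lambda>x. 0)"
    by (simp add: graph_chart_def smooth_on_def cylinder_def Ck)
  then have F': "insert {} F \<subseteq> ?F" using F(1) by (intro insert_subsetI) auto
  define U where "U = from_nat_into (insert {} F)"
  have rU: "range U = insert {} F"
    unfolding U_def using F(2) by (intro range_from_nat_into) auto
  have "U k \<in> ?F" for k by (rule subsetD[OF F']) (use rU in auto)
  then have "\<forall>k. \<exists>i g. graph_chart S i (U k) g" by simp
  then obtain I where "\<forall>k. \<exists>g. graph_chart S (I k) (U k) g" by (auto dest!: choice)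
  then obtain G where "\<And>k. graph_chart S (I k) (U k) (G k)" by (auto dest!: choice)
  moreover have "S \<subseteq> (\<Union>k. U k)" unfolding rU using SF by auto
  ultimately show ?thesis using that by blast
qed

lemma countable_chart_pieces:
  assumes S: "closed S" "smooth_hypersurface S"
  obtains I U G D where "\<And>k::nat. graph_chart S (I k) (U k) (G k)" "\<And>k. D k \<in> sets borel"
    "\<And>k. D k \<subseteq> S \<inter> U k" "disjoint_family D" "(\<Union>k. D k) = S"
proof -
  obtain I U G where ch: "\<And>k::nat. graph_chart S (I k) (U k) (G k)" and SU: "S \<subseteq> (\<Union>k. U k)"
    using countable_charts[OF S(2)] by blast
  define D where "D k = S \<inter> disjointed U k" for k
  have "U k \<in> sets borel" for k using graph_chartD(1)[OF ch] by (rule borel_open)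
  then have "range U \<subseteq> sets borel" by auto
  then have "disjointed U k \<in> sets borel" for k using sets.range_disjointed_sets by blast
  then have 1: "D k \<in> sets borel" for k
    unfolding D_def using borel_closed[OF S(1)] by (intro sets.Int) auto
  have 2: "D k \<subseteq> S \<inter> U k" for k using disjointed_subset[of U k] by (auto simp: D_def)
  have 3: "disjoint_family D"
    using disjoint_family_disjointed[of U] by (auto simp: disjoint_family_on_def D_def)
  have "(\<Union>k. D k) = S \<inter> (\<Union>k. disjointed U k)" by (auto simp: D_def)
  then have 4: "(\<Union>k. D k) = S" using SU by (auto simp: UN_disjointed_eq)
  show ?thesis using that[OF ch 1 2 3 4] .
qed

lemma emeasure_pieces:
  assumes "sets M = sets borel" "A \<in> sets borel" "\<And>k::nat. D k \<in> sets borel" "disjoint_family D" "A \<subseteq> (\<Union>k. D k)"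
  shows "emeasure M A = (\<Sum>k. emeasure M (A \<inter> D k))"
proof -
  have "(\<Sum>k. emeasure M (A \<inter> D k)) = emeasure M (\<Union>k. A \<inter> D k)"
    using assms(2-4) by (intro suminf_emeasure) (auto simp: assms(1) disjoint_family_on_def)
  also have "(\<Union>k. A \<inter> D k) = A" using assms(5) by auto
  finally show ?thesis ..
qed

text \<open>
  The surface measure is glued from countably many measures, each living on one chart.
\<close>

lemma sum_measure_exists:
  fixes \<mu> :: "nat \<Rightarrow> 'a::topological_space measure"
  assumes "\<And>k. sets (\<mu> k) = sets borel"
  obtains M where "sets M = sets borel" "\<And>A. A \<in> sets borel \<Longrightarrow> emeasure M A = (\<Sum>k. emeasure (\<mu> k) A)"
proof
  let ?f = "\<lambda>A. \<Sum>k. emeasure (\<mu> k) A"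
  let ?M = "measure_of UNIV (sets borel) ?f"
  have "sigma_algebra (UNIV :: 'a set) (sets borel)" using sets.sigma_algebra_axioms[of "borel :: 'a measure"] by simp
  then show s: "sets ?M = sets borel" by (simp add: sigma_algebra.sigma_sets_eq)
  have "countably_additive (sets borel) ?f"
  proof (rule countably_additiveI)
    fix A :: "nat \<Rightarrow> 'a set" assume A: "range A \<subseteq> sets borel" "disjoint_family A"
    have "(\<Sum>n. ?f (A n)) = (\<Sum>n. \<integral>\<^sup>+k. emeasure (\<mu> k) (A n) \<partial>count_space UNIV)"
      by (simp add: nn_integral_count_space_nat)
    also have "\<dots> = (\<integral>\<^sup>+k. (\<Sum>n. emeasure (\<mu> k) (A n)) \<partial>count_space UNIV)"
      by (intro nn_integral_suminf[symmetric]) auto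
    also have "\<dots> = (\<integral>\<^sup>+k. emeasure (\<mu> k) (\<Union>n. A n) \<partial>count_space UNIV)"
      using A assms by (intro nn_integral_cong suminf_emeasure) auto
    also have "\<dots> = ?f (\<Union>n. A n)" by (simp add: nn_integral_count_space_nat)
    finally show "(\<Sum>n. ?f (A n)) = ?f (\<Union>n. A n)" .
  qed
  then show "emeasure ?M A = ?f A" if "A \<in> sets borel" for A
    using that s by (intro emeasure_measure_of[OF refl]) (auto simp: positive_def)
qed

text \<open>
  Both measures vanish off \<open>S\<close> and are given by graph areas on the disjoint pieces.
\<close>

lemma is_surface_measure_unique:
  assumes S: "closed S" "smooth_hypersurface S"
    and M: "is_surface_measure S M" "is_surface_measure S M'"
  shows "M = M'"
proof (rule measure_eqI)
  show "sets M = sets M'" using M by (simp add: is_surface_measure_def)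
  fix A assume "A \<in> sets M"
  then have A: "A \<in> sets borel" using M by (simp add: is_surface_measure_def)
  have Sb: "S \<in> sets borel" using S(1) by (rule borel_closed)
  obtain I U G D where ch: "\<And>k::nat. graph_chart S (I k) (U k) (G k)" and D: "\<And>k. D k \<in> sets borel"
    "\<And>k. D k \<subseteq> S \<inter> U k" "disjoint_family D" "(\<Union>k. D k) = S"
    using countable_chart_pieces[OF S] by blast
  have "emeasure N A = (\<Sum>k. graph_area (I k) (G k) (A \<inter> D k))" if N: "is_surface_measure S N" for N
  proof -
    have sN: "sets N = sets borel" and N0: "emeasure N (- S) = 0"
      using N by (auto simp: is_surface_measure_def)
    have "emeasure N A = emeasure N (A \<inter> S)"
    proof (rule emeasure_eq_AE)
      have "- S \<in> null_sets N" using N0 Sb sN by auto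
      then have "AE x in N. x \<notin> - S" by (rule AE_not_in)
      then show "AE x in N. x \<in> A \<longleftrightarrow> x \<in> A \<inter> S" by eventually_elim auto
    qed (use A Sb sN in auto)
    also have "\<dots> = (\<Sum>k. emeasure N (A \<inter> S \<inter> D k))"
      using A Sb D by (intro emeasure_pieces sN) auto
    also have "\<dots> = (\<Sum>k. emeasure N (A \<inter> D k))"
      using D(4) by (intro suminf_cong arg_cong[where f = "emeasure N"]) auto
    also have "\<dots> = (\<Sum>k. graph_area (I k) (G k) (A \<inter> D k))"
    proof (intro suminf_cong)
      fix k
      have "A \<inter> D k \<in> sets borel" "A \<inter> D k \<subseteq> S \<inter> U k" using A D(1,2)[of k] by auto
      then show "emeasure N (A \<inter> D k) = graph_area (I k) (G k) (A \<inter> D k)"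
        using N[unfolded is_surface_measure_def, THEN conjunct2, THEN conjunct2, rule_format, OF ch[of k]] by simp
    qed
    finally show ?thesis .
  qed
  then show "emeasure M A = emeasure M' A" using M by simp
qed

lemma is_surface_measure_exists:
  assumes S: "closed S" "smooth_hypersurface S"
  shows "\<exists>M. is_surface_measure S M"
proof -
  obtain I U G D where ch: "\<And>k::nat. graph_chart S (I k) (U k) (G k)" and D: "\<And>k. D k \<in> sets borel"
    "\<And>k. D k \<subseteq> S \<inter> U k" "disjoint_family D" "(\<Union>k. D k) = S"
    using countable_chart_pieces[OF S] by blast
  have "\<forall>k. \<exists>\<mu>. sets \<mu> = sets borel \<and>
    (\<forall>A\<in>sets borel. emeasure \<mu> A = chart_integral (I k) (G k) (A \<inter> D k) (area_element (I k) (G k)))"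
  proof
    fix k
    have DU: "D k \<subseteq> U k" using D(2)[of k] by auto
    obtain \<mu> where "sets \<mu> = sets borel"
      "\<And>A. A \<in> sets borel \<Longrightarrow> emeasure \<mu> A = chart_integral (I k) (G k) (A \<inter> D k) (area_element (I k) (G k))"
      by (rule chart_area_measure[OF ch[of k] D(1)[of k] DU]) simp
    then show "\<exists>\<mu>. sets \<mu> = sets borel \<and>
      (\<forall>A\<in>sets borel. emeasure \<mu> A = chart_integral (I k) (G k) (A \<inter> D k) (area_element (I k) (G k)))"
      by blast
  qed
  from choice[OF this] obtain \<mu> where \<mu>: "\<And>k. sets (\<mu> k) = sets borel"
    "\<And>k A. A \<in> sets borel \<Longrightarrow>
       emeasure (\<mu> k) A = chart_integral (I k) (G k) (A \<inter> D k) (area_element (I k) (G k))"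
    by blast
  obtain M where M: "sets M = sets borel" "\<And>A. A \<in> sets borel \<Longrightarrow> emeasure M A = (\<Sum>k. emeasure (\<mu> k) A)"
    using sum_measure_exists[of \<mu>] \<mu>(1) by blast
  have "is_surface_measure S M"
    unfolding is_surface_measure_def
  proof (intro conjI allI impI ballI)
    show "sets M = sets borel" by (rule M)
    have "- S \<inter> D k = {}" for k using D(4) by auto
    moreover have "- S \<in> sets borel" using S(1) by (intro borel_open open_Compl)
    ultimately show "emeasure M (- S) = 0" by (simp add: M(2) \<mu>(2) chart_integral_def)
  next
    fix i U' g A assume ch': "graph_chart S i U' g" and A: "A \<in> sets borel" "A \<subseteq> S \<inter> U'"
    then have AU: "A \<subseteq> U'" by auto
    obtain \<nu> where \<nu>: "sets \<nu> = sets borel"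
      "\<And>B. B \<in> sets borel \<Longrightarrow> emeasure \<nu> B = chart_integral i g (B \<inter> A) (area_element i g)"
      by (rule chart_area_measure[OF ch' A(1) AU]) simp
    have "emeasure M A = (\<Sum>k. chart_integral (I k) (G k) (A \<inter> D k) (area_element (I k) (G k)))"
      using A by (simp add: M \<mu>)
    also have "\<dots> = (\<Sum>k. emeasure \<nu> (A \<inter> D k))"
    proof (intro suminf_cong)
      fix k
      have AD: "A \<inter> D k \<in> sets borel" "A \<inter> D k \<subseteq> S \<inter> U k \<inter> U'" using A D(1,2)[of k] by auto
      have "A \<inter> D k \<inter> A = A \<inter> D k" by auto
      then show "chart_integral (I k) (G k) (A \<inter> D k) (area_element (I k) (G k)) = emeasure \<nu> (A \<inter> D k)"
        using chart_integral_area_eq[OF ch ch' AD] \<nu>(2)[OF AD(1)] by simp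
    qed
    also have "\<dots> = emeasure \<nu> A"
      using A D by (intro emeasure_pieces[symmetric] \<nu>) auto
    also have "\<dots> = graph_area i g A"
      using A AU by (simp add: \<nu>(2) graph_area_eq_chart_integral[OF ch'])
    finally show "emeasure M A = graph_area i g A" .
  qed
  then show ?thesis by blast
qed

lemma is_surface_measure_surface_measure:
  assumes "closed S" "smooth_hypersurface S"
  shows "is_surface_measure S (surface_measure S)"
  unfolding surface_measure_def
  using is_surface_measure_exists[OF assms] is_surface_measure_unique[OF assms] by (metis theI)

lemma sets_surface_measure:
  assumes "closed S" "smooth_hypersurface S"
  shows "sets (surface_measure S) = sets borel"
  using is_surface_measure_surface_measure[OF assms] by (simp add: is_surface_measure_def)

lemma emeasure_surface_measure:
  assumes S: "closed S" "smooth_hypersurface S" and ch: "graph_chart S i U g"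
    and A: "A \<in> sets borel" "A \<subseteq> S \<inter> U"
  shows "emeasure (surface_measure S) A = chart_integral i g A (area_element i g)"
proof -
  have "A \<subseteq> U" using A by auto
  then show ?thesis
    using is_surface_measure_surface_measure[OF S] ch A graph_area_eq_chart_integral[OF ch A(1)]
    unfolding is_surface_measure_def by metis
qed

lemma nn_integral_surface_measure:
  assumes S: "closed S" "smooth_hypersurface S" and ch: "graph_chart S i U g"
    and A: "A \<in> sets borel" "A \<subseteq> S \<inter> U" and f: "f \<in> borel_measurable borel"
  shows "(\<integral>\<^sup>+x. f x * indicator A x \<partial>surface_measure S) = chart_integral i g A (\<lambda>x. f x * area_element i g x)"
proof -
  let ?M = "surface_measure S"
  have AU: "A \<subseteq> U" using A by auto
  note sM = sets_surface_measure[OF S]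
  obtain \<mu> where \<mu>: "sets \<mu> = sets borel"
    "\<And>f. f \<in> borel_measurable borel \<Longrightarrow>
        (\<integral>\<^sup>+x. f x \<partial>\<mu>) = chart_integral i g A (\<lambda>x. f x * area_element i g x)"
    "\<And>B. B \<in> sets borel \<Longrightarrow> emeasure \<mu> B = chart_integral i g (B \<inter> A) (area_element i g)"
    using chart_area_measure[OF ch A(1) AU] by blast
  have "density ?M (indicator A) = \<mu>"
  proof (rule measure_eqI)
    fix B assume "B \<in> sets (density ?M (indicator A))"
    then have B: "B \<in> sets borel" by (simp add: sM)
    have "emeasure (density ?M (indicator A)) B = emeasure ?M (A \<inter> B)"
      using A B sM by (simp add: emeasure_restricted)
    also have "\<dots> = emeasure \<mu> B"
      using A B by (subst emeasure_surface_measure[OF S ch]) (auto simp: \<mu>(3) Int_commute)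
    finally show "emeasure (density ?M (indicator A)) B = emeasure \<mu> B" .
  qed (simp add: sM \<mu>)
  moreover have "(\<integral>\<^sup>+x. f x \<partial>density ?M (indicator A)) = (\<integral>\<^sup>+x. indicator A x * f x \<partial>?M)"
    using A f by (intro nn_integral_density) (auto simp: sM cong: measurable_cong_sets)
  ultimately show ?thesis using \<mu>(2)[OF f] by (simp add: mult.commute)
qed

text \<open>
  The domain of a chart may be unbounded and its gradient too, but near each point of \<open>S\<close> the
  area element is bounded, and finitely many such neighbourhoods cover a compact part of \<open>S\<close>.
  Finiteness is what allows splitting the integral of \<open>1 - \<parallel>N\<parallel>\<^sub>1 / sqrt n\<close>.
\<close>

lemma emeasure_surface_measure_compact:
  fixes S :: "(real ^ 'n) set"
  assumes S: "closed S" "smooth_hypersurface S" and C: "compact C"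
  shows "emeasure (surface_measure S) (C \<inter> S) < \<infinity>"
proof -
  let ?M = "surface_measure S"
  have loc: "\<exists>V. open V \<and> p \<in> V \<and> emeasure ?M (S \<inter> V) < \<infinity>" if p: "p \<in> S" for p
  proof -
    obtain i U g where ch: "graph_chart S i U g" and pU: "p \<in> U"
      using S p unfolding smooth_hypersurface_def by blast
    define c where "c = norm (chart_normal i g p) + 1"
    define V where "V = U \<inter> (\<lambda>x. norm (chart_normal i g x)) -` {..<c} \<inter> ball p 1"
    have "continuous_on U (\<lambda>x. norm (chart_normal i g x))"
      by (intro continuous_intros continuous_on_subset[OF continuous_on_chart_normal[OF ch]])
         (auto intro: subset_cylinder)
    then have V: "open V"
      unfolding V_def using graph_chartD(1)[OF ch]
      by (intro open_Int[OF _ open_ball] continuous_open_preimage) auto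
    have pV: "p \<in> V" using pU by (simp add: V_def c_def)
    have SV: "S \<inter> V \<in> sets borel" "S \<inter> V \<subseteq> S \<inter> U" using S(1) V by (auto simp: V_def)
    define Q where "Q = cbox (\<chi> k. if k = i then 0 else p $ k - 1) (\<chi> k. if k = i then 1 else p $ k + 1)"
    have "emeasure ?M (S \<inter> V) = chart_integral i g (S \<inter> V) (area_element i g)"
      by (rule emeasure_surface_measure[OF S ch SV])
    also have "\<dots> \<le> (\<integral>\<^sup>+x. ennreal c * indicator Q x \<partial>lborel)"
      unfolding chart_integral_def
    proof (intro nn_integral_mono)
      fix x
      let ?y = "set_coord i (g x) x"
      show "area_element i g ?y * indicator (S \<inter> V) ?y * indicator (slab i) x \<le> ennreal c * indicator Q x"
      proof (cases "?y \<in> S \<inter> V \<and> x \<in> slab i")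
        case True
        then have y: "norm (chart_normal i g ?y) < c" "dist p ?y < 1" by (auto simp: V_def)
        have "\<bar>?y $ k - p $ k\<bar> < 1" for k
          using y(2) component_le_norm_cart[of "?y - p" k] by (simp add: dist_norm norm_minus_commute del: set_coord_nth)
        then have "\<bar>x $ k - p $ k\<bar> < 1" if "k \<noteq> i" for k using that by (metis set_coord_nth)
        then have "x \<in> Q" using True by (fastforce simp: Q_def mem_box_cart slab_def abs_less_iff)
        then show ?thesis using y(1) by (auto simp: indicator_def intro: ennreal_leI)
      qed auto
    qed
    also have "\<dots> = ennreal c * emeasure lborel Q"
      by (simp add: nn_integral_cmult Q_def)
    also have "\<dots> < \<infinity>"
      using emeasure_bounded_finite[of Q] by (auto simp: Q_def ennreal_mult_less_top)
    finally show ?thesis using V pV by blast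
  qed
  then obtain V where V: "\<And>p. p \<in> S \<Longrightarrow> open (V p) \<and> p \<in> V p \<and> emeasure ?M (S \<inter> V p) < \<infinity>" by metis
  have "compact (C \<inter> S)" using C S(1) by (rule compact_Int_closed)
  moreover have "C \<inter> S \<subseteq> (\<Union>p\<in>S. V p)" using V by blast
  ultimately obtain T where T: "T \<subseteq> S" "finite T" "C \<inter> S \<subseteq> (\<Union>p\<in>T. V p)"
    using V by (metis compactE_image)
  have m: "S \<inter> V p \<in> sets ?M" if "p \<in> T" for p
    using V T(1) that S(1) sets_surface_measure[OF S] by auto
  have "emeasure ?M (C \<inter> S) \<le> emeasure ?M (\<Union>p\<in>T. S \<inter> V p)"
    using T m by (intro emeasure_mono sets.finite_UN) auto
  also have "\<dots> \<le> (\<Sum>p\<in>T. emeasure ?M (S \<inter> V p))"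
    using m T(2) by (intro emeasure_subadditive_finite) auto
  also have "\<dots> < \<infinity>"
    using V T by (auto simp: less_top)
  finally show ?thesis .
qed

section \<open>The surface integral of the normal components\<close>

lemma unit_cube_eq_cbox: "unit_cube = cbox (\<chi> i. -1/2) (\<chi> i. 1/2)"
  by (auto simp: unit_cube_def mem_box_cart)

lemma compact_unit_cube: "compact unit_cube"
  by (simp add: unit_cube_eq_cbox)

lemma sets_unit_cube_Int: "closed S \<Longrightarrow> unit_cube \<inter> S \<in> sets borel"
  by (intro borel_closed closed_Int compact_imp_closed[OF compact_unit_cube])

text \<open>
  The shadow of the unit cube along \<open>e\<^sub>j\<close>, in slab form.
\<close>

definition shadow_cube :: "'n \<Rightarrow> (real ^ 'n) set" where
  "shadow_cube j = {z \<in> slab j. \<forall>k. k \<noteq> j \<longrightarrow> z $ k \<in> {-1/2..1/2}}"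

lemma shadow_cube:
  fixes j :: "'n::finite"
  shows sets_shadow_cube: "shadow_cube j \<in> sets borel"
    and emeasure_shadow_cube: "emeasure lborel (shadow_cube j) = 1"
proof -
  let ?l = "(\<chi> k. if k = j then 0 else -1/2) :: real ^ 'n"
  let ?u = "(\<chi> k. if k = j then 1 else 1/2) :: real ^ 'n"
  have eq: "shadow_cube j = cbox ?l ?u"
  proof (intro set_eqI iffI)
    show "z \<in> cbox ?l ?u" if "z \<in> shadow_cube j" for z
      using that by (auto simp: shadow_cube_def slab_def mem_box_cart)
    show "z \<in> shadow_cube j" if "z \<in> cbox ?l ?u" for z
      using that unfolding shadow_cube_def slab_def mem_box_cart
      by (auto dest: spec[of _ j] split: if_splits)
  qed
  then show "shadow_cube j \<in> sets borel" by simp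
  have "emeasure lborel (shadow_cube j) = (\<Prod>k\<in>UNIV. (?u - ?l) $ k)"
    unfolding eq by (subst emeasure_lborel_cbox)
      (force simp: Basis_vec_def inner_axis, simp add: prod_Basis_cart inner_axis)
  also have "(\<Prod>k\<in>UNIV. (?u - ?l) $ k) = 1"
    by (rule prod.neutral) auto
  finally show "emeasure lborel (shadow_cube j) = 1" by simp
qed

text \<open>
  Periodicity holds only up to null sets, so it says nothing about the endpoints
  themselves. But if the segment missed the frontier, whole neighbourhoods of the endpoints would be on the
  same side, and a nonempty open set is not negligible. Hence the conclusion holds for every
  segment, without exceptional null set.
\<close>

lemma unit_segment_meets_frontier:
  fixes \<Omega> :: "(real ^ 'n) set"
  assumes "periodic_set \<Omega>"
  shows "\<exists>t\<in>{-1/2..1/2}. set_coord j t z \<in> frontier \<Omega>"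
proof (rule ccontr)
  assume "\<not> ?thesis"
  then have no: "set_coord j t z \<notin> frontier \<Omega>" if "t \<in> {-1/2..1/2}" for t using that by blast
  let ?C = "(\<lambda>t. set_coord j t z) ` {-1/2..1/2}"
  define e where "e = (axis j 1 :: real ^ 'n)"
  define b where "b = set_coord j (1/2) z"
  have be: "b - e = set_coord j (-1/2) z" by (simp add: b_def e_def vec_eq_iff axis_def)
  have C: "b \<in> ?C" "b - e \<in> ?C" unfolding b_def be[unfolded b_def] by auto
  have "connected ?C"
    by (intro connected_continuous_image continuous_intros) auto
  moreover have "?C \<inter> frontier \<Omega> = {}" using no by auto
  ultimately have "?C \<inter> \<Omega> = {} \<or> ?C - \<Omega> = {}" using connected_Int_frontier by blast
  then have side: "b \<in> \<Omega> \<longleftrightarrow> b - e \<in> \<Omega>" using C by blast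
  have nf: "b \<notin> frontier \<Omega>" "b - e \<notin> frontier \<Omega>"
    unfolding be using no[of "1/2"] no[of "-1/2"] by (auto simp: b_def)
  let ?bad = "sym_diff ((\<lambda>x. x + e) ` \<Omega>) (- \<Omega>)"
  have shift: "y \<in> (\<lambda>x. x + e) ` \<Omega> \<longleftrightarrow> y - e \<in> \<Omega>" for y
    by (auto simp: image_iff algebra_simps intro!: bexI[of _ "y - e"])
  have "negligible ?bad" using assms unfolding periodic_set_def e_def by blast
  moreover have "\<exists>W. open W \<and> b \<in> W \<and> W \<subseteq> ?bad"
  proof (cases "b \<in> \<Omega>")
    case True
    let ?W = "interior \<Omega> \<inter> (\<lambda>y. y - e) -` interior \<Omega>"
    have "open ?W" by (intro open_Int open_interior open_vimage continuous_intros)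
    moreover have "b \<in> ?W"
      using True side nf closure_subset[of \<Omega>] by (auto simp: frontier_def)
    moreover have "?W \<subseteq> ?bad" using interior_subset[of \<Omega>] by (auto simp: shift)
    ultimately show ?thesis by blast
  next
    case False
    let ?W = "interior (- \<Omega>) \<inter> (\<lambda>y. y - e) -` interior (- \<Omega>)"
    have "open ?W" by (intro open_Int open_interior open_vimage continuous_intros)
    moreover have "b \<in> ?W"
      using False side nf interior_subset[of \<Omega>] by (auto simp: frontier_def interior_complement)
    moreover have "?W \<subseteq> ?bad" using interior_subset[of "- \<Omega>"] by (auto simp: shift)
    ultimately show ?thesis by blast
  qed
  ultimately show False
    using negligible_subset open_not_negligible by blast
qed

lemma abs_unit_normal_measurable:
  fixes S :: "(real ^ 'n) set"
  assumes S: "closed S" "smooth_hypersurface S" and N: "\<And>x. x \<in> S \<Longrightarrow> is_unit_normal S x (N x)"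
  shows "(\<lambda>x. indicator S x *\<^sub>R \<bar>N x $ k\<bar>) \<in> borel_measurable borel"
  using S by (intro borel_measurable_continuous_on_indicator continuous_on_abs_unit_normal N) auto

text \<open>
  The shadows of the pieces of \<open>S\<close> in the cube cover the shadow of the cube, which has measure
  \<open>1\<close>. On each piece, \<open>\<bar>N\<^sub>j\<bar>\<close> times the area element is the \<open>j\<close>-th component of the chart normal.
\<close>

lemma surface_integral_normal_component_ge_1:
  fixes S :: "(real ^ 'n) set"
  assumes S: "closed S" "smooth_hypersurface S" and N: "\<And>x. x \<in> S \<Longrightarrow> is_unit_normal S x (N x)"
    and seg: "\<And>z. \<exists>t\<in>{-1/2..1/2}. set_coord j t z \<in> S"
  shows "1 \<le> (\<integral>\<^sup>+x. ennreal \<bar>N x $ j\<bar> * indicator (unit_cube \<inter> S) x \<partial>surface_measure S)"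
proof -
  let ?M = "surface_measure S"
  note sM = sets_surface_measure[OF S]
  define f where "f x = ennreal (indicator S x *\<^sub>R \<bar>N x $ j\<bar>)" for x
  have f: "f \<in> borel_measurable borel"
    unfolding f_def using abs_unit_normal_measurable[OF S N] by simp
  obtain I U G D where ch: "\<And>k::nat. graph_chart S (I k) (U k) (G k)" and D: "\<And>k. D k \<in> sets borel"
    "\<And>k. D k \<subseteq> S \<inter> U k" "disjoint_family D" "(\<Union>k. D k) = S"
    using countable_chart_pieces[OF S] by blast
  define A where "A k = unit_cube \<inter> D k" for k
  have A: "A k \<in> sets borel" "A k \<subseteq> S \<inter> U k" for k
    unfolding A_def using D(1,2)[of k] borel_closed[OF compact_imp_closed[OF compact_unit_cube]]
    by (blast intro: sets.Int)+
  have A_disj: "disjoint_family A" using D(3) by (auto simp: A_def disjoint_family_on_def)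
  have A_UN: "(\<Union>k. A k) = unit_cube \<inter> S" using D(4) by (auto simp: A_def)
  have "\<forall>k. \<exists>E. E \<in> sets borel \<and> {z \<in> slab j. \<exists>t. set_coord j t z \<in> A k} \<subseteq> E \<and>
     emeasure lborel E \<le> chart_integral (I k) (G k) (A k) (\<lambda>x. ennreal \<bar>chart_normal (I k) (G k) x $ j\<bar>)"
    using projection_le_chart_integral[OF ch A] by (auto simp: Bex_def)
  from choice[OF this] obtain E where E: "\<And>k. E k \<in> sets borel"
    "\<And>k. {z \<in> slab j. \<exists>t. set_coord j t z \<in> A k} \<subseteq> E k"
    "\<And>k. emeasure lborel (E k) \<le>
        chart_integral (I k) (G k) (A k) (\<lambda>x. ennreal \<bar>chart_normal (I k) (G k) x $ j\<bar>)"
    by blast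
  have "shadow_cube j \<subseteq> (\<Union>k. E k)"
  proof
    fix z assume z: "z \<in> shadow_cube j"
    obtain t where t: "t \<in> {-1/2..1/2}" "set_coord j t z \<in> S" using seg by blast
    then have "set_coord j t z \<in> unit_cube \<inter> S" using z by (auto simp: unit_cube_def shadow_cube_def)
    then obtain k where "set_coord j t z \<in> A k" using A_UN by blast
    then have "z \<in> {z \<in> slab j. \<exists>t. set_coord j t z \<in> A k}" using z by (auto simp: shadow_cube_def)
    then show "z \<in> (\<Union>k. E k)" using E(2) by blast
  qed
  then have "1 \<le> emeasure lborel (\<Union>k. E k)"
    using emeasure_mono[of "shadow_cube j" "\<Union>k. E k" lborel] E(1) emeasure_shadow_cube[of j] by auto
  also have "\<dots> \<le> (\<Sum>k. emeasure lborel (E k))"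
    using E(1) by (intro emeasure_subadditive_countably) auto
  also have "\<dots> \<le> (\<Sum>k. \<integral>\<^sup>+x. f x * indicator (A k) x \<partial>?M)"
  proof (intro suminf_le summableI)
    fix k
    have "chart_integral (I k) (G k) (A k) (\<lambda>x. ennreal \<bar>chart_normal (I k) (G k) x $ j\<bar>)
        = chart_integral (I k) (G k) (A k) (\<lambda>x. f x * area_element (I k) (G k) x)"
    proof (rule chart_integral_cong)
      fix x assume "x \<in> A k"
      then have x: "x \<in> S" "x \<in> U k" using A(2) by auto
      show "ennreal \<bar>chart_normal (I k) (G k) x $ j\<bar> = f x * area_element (I k) (G k) x"
        using unit_normal_component[OF ch x N[OF x(1)], of j] x(1)
        by (simp add: f_def mult.commute flip: ennreal_mult)
    qed
    also have "\<dots> = (\<integral>\<^sup>+x. f x * indicator (A k) x \<partial>?M)"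
      by (rule nn_integral_surface_measure[OF S ch A f, symmetric])
    finally show "emeasure lborel (E k) \<le> (\<integral>\<^sup>+x. f x * indicator (A k) x \<partial>?M)"
      using E(3)[of k] by simp
  qed
  also have "\<dots> = (\<integral>\<^sup>+x. f x * indicator (\<Union>k. A k) x \<partial>?M)"
    using f A A_disj by (intro nn_integral_disjoint_family[symmetric]) (auto simp: sM cong: measurable_cong_sets)
  also have "\<dots> = (\<integral>\<^sup>+x. ennreal \<bar>N x $ j\<bar> * indicator (unit_cube \<inter> S) x \<partial>?M)"
    unfolding A_UN by (intro nn_integral_cong) (auto simp: f_def indicator_def)
  finally show ?thesis .
qed

lemma cube_surface_integral_1:
  fixes S :: "(real ^ 'n) set"
  assumes "closed S" "smooth_hypersurface S"
  shows "cube_surface_integral S (\<lambda>x. 1) = measure (surface_measure S) (unit_cube \<inter> S)"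
proof -
  have "unit_cube \<inter> S \<in> sets (surface_measure S)"
    using sets_unit_cube_Int[OF assms(1)] by (simp add: sets_surface_measure assms)
  moreover have "emeasure (surface_measure S) (unit_cube \<inter> S) < \<infinity>"
    using emeasure_surface_measure_compact[OF assms compact_unit_cube] .
  ultimately show ?thesis
    by (simp add: cube_surface_integral_def set_lebesgue_integral_def)
qed

text \<open>
  Summing the previous bound over the \<open>n\<close> coordinates gives \<open>\<integral> \<parallel>N\<parallel>\<^sub>1 \<ge> n\<close>; division by \<open>sqrt n\<close>
  produces the constant \<open>sqrt n\<close>.
\<close>

lemma cube_surface_integral_ge:
  fixes S :: "(real ^ 'n) set"
  assumes S: "closed S" "smooth_hypersurface S" and N: "\<And>x. x \<in> S \<Longrightarrow> is_unit_normal S x (N x)"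
    and seg: "\<And>j z. \<exists>t\<in>{-1/2..1/2}. set_coord j t z \<in> S"
  shows "cube_surface_integral S (\<lambda>x. 1) \<ge>
     sqrt (real CARD('n)) + cube_surface_integral S (\<lambda>x. 1 - l1_norm (N x) / sqrt (real CARD('n)))"
proof -
  let ?M = "surface_measure S"
  let ?A = "unit_cube \<inter> S"
  let ?n = "real CARD('n)"
  note sM = sets_surface_measure[OF S]
  have A: "?A \<in> sets ?M" using sets_unit_cube_Int[OF S(1)] by (simp add: sM)
  have fin: "emeasure ?M ?A < \<infinity>"
    using emeasure_surface_measure_compact[OF S compact_unit_cube] .
  define h where "h x = (\<Sum>k\<in>UNIV. indicator S x *\<^sub>R \<bar>N x $ k\<bar>)" for x
  have hb: "h \<in> borel_measurable ?M"
    unfolding h_def measurable_cong_sets[OF sM refl]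
    by (intro borel_measurable_sum abs_unit_normal_measurable[OF S N])
  have h_l1: "indicator ?A x *\<^sub>R h x = indicator ?A x *\<^sub>R l1_norm (N x)" for x
    by (auto simp: h_def l1_norm_def indicator_def)
  have h_le: "norm (h x) \<le> ?n" if "x \<in> ?A" for x
  proof -
    have "\<bar>N x $ k\<bar> \<le> 1" for k
      using N[of x] that component_le_norm_cart[of "N x" k] by (simp add: is_unit_normal_def)
    then have "(\<Sum>k\<in>UNIV. \<bar>N x $ k\<bar>) \<le> (\<Sum>k\<in>(UNIV :: 'n set). 1)" by (intro sum_mono)
    moreover have "0 \<le> (\<Sum>k\<in>UNIV. \<bar>N x $ k\<bar>)" by (intro sum_nonneg) auto
    ultimately show ?thesis using that by (simp add: h_def)
  qed
  have int_h: "integrable ?M (\<lambda>x. indicator ?A x *\<^sub>R h x)"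
    using A hb fin h_le by (intro integrableI_bounded_set_indicator[where B = ?n]) auto
  then have int_l1: "set_integrable ?M ?A (\<lambda>x. l1_norm (N x))"
    unfolding set_integrable_def h_l1 .
  have int_1: "set_integrable ?M ?A (\<lambda>x. 1 :: real)"
    unfolding set_integrable_def using A fin by simp
  define L where "L = (LINT x:?A|?M. l1_norm (N x))"
  have "?n \<le> L"
  proof -
    have "(\<Sum>j\<in>(UNIV :: 'n set). 1 :: ennreal) \<le>
        (\<Sum>j\<in>UNIV. \<integral>\<^sup>+x. ennreal \<bar>N x $ j\<bar> * indicator ?A x \<partial>?M)"
      by (intro sum_mono surface_integral_normal_component_ge_1[OF S N seg])
    also have "\<dots> = (\<Sum>j\<in>UNIV. \<integral>\<^sup>+x. ennreal (indicator S x *\<^sub>R \<bar>N x $ j\<bar>) * indicator ?A x \<partial>?M)"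
      by (intro sum.cong nn_integral_cong) (auto simp: indicator_def)
    also have "\<dots> = (\<integral>\<^sup>+x. (\<Sum>j\<in>UNIV. ennreal (indicator S x *\<^sub>R \<bar>N x $ j\<bar>) * indicator ?A x) \<partial>?M)"
    proof (rule nn_integral_sum[symmetric])
      fix j
      have "(\<lambda>x. indicator S x *\<^sub>R \<bar>N x $ j\<bar>) \<in> borel_measurable ?M"
        unfolding measurable_cong_sets[OF sM refl] by (rule abs_unit_normal_measurable[OF S N])
      then show "(\<lambda>x. ennreal (indicator S x *\<^sub>R \<bar>N x $ j\<bar>) * indicator ?A x) \<in> borel_measurable ?M"
        using A by measurable
    qed
    also have "\<dots> = (\<integral>\<^sup>+x. ennreal (indicator ?A x *\<^sub>R h x) \<partial>?M)"
      by (intro nn_integral_cong) (auto simp: h_def indicator_def sum_ennreal)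
    also have "\<dots> = ennreal (\<integral>x. indicator ?A x *\<^sub>R h x \<partial>?M)"
      using int_h by (intro nn_integral_eq_integral) (auto simp: h_def intro!: sum_nonneg)
    also have "(\<integral>x. indicator ?A x *\<^sub>R h x \<partial>?M) = L"
      unfolding L_def set_lebesgue_integral_def h_l1 ..
    finally have "ennreal ?n \<le> ennreal L" by (simp add: ennreal_of_nat_eq_real_of_nat)
    moreover have "0 < ?n" by simp
    ultimately show ?thesis by (simp add: ennreal_le_iff2)
  qed
  have "cube_surface_integral S (\<lambda>x. 1 - l1_norm (N x) / sqrt ?n) = cube_surface_integral S (\<lambda>x. 1) - L / sqrt ?n"
    unfolding cube_surface_integral_def L_def using int_1 int_l1
    by (subst set_integral_diff) auto
  moreover have "sqrt ?n \<le> L / sqrt ?n"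
    using \<open>?n \<le> L\<close> by (simp add: field_simps)
  ultimately show ?thesis by simp
qed

section \<open>Periodic half spaces\<close>

lemma has_derivative_affine:
  fixes a :: "real ^ 'n"
  shows "((\<lambda>x. c + a \<bullet> x) has_derivative (\<lambda>x. a \<bullet> x)) (at x)"
  by (auto intro!: derivative_eq_intros)

lemma partial_deriv_affine: "partial_deriv k (\<lambda>x. c + a \<bullet> x) = (\<lambda>x. a $ k)"
  using frechet_derivative_at[OF has_derivative_affine[of c a]]
  by (simp add: partial_deriv_def fun_eq_iff inner_axis)

lemma smooth_on_affine: "smooth_on (\<lambda>x :: real ^ 'n. c + a \<bullet> x) U"
proof -
  have const: "Ck_on k (\<lambda>x :: real ^ 'n. d) U" for k d
  proof (induction k arbitrary: d)
    case (Suc k)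
    have "partial_deriv j (\<lambda>x :: real ^ 'n. d) = (\<lambda>x. 0)" for j
      using partial_deriv_affine[of j d 0] by simp
    then show ?case using Suc by simp
  qed simp
  have "Ck_on k (\<lambda>x. c + a \<bullet> x) U" for k
  proof (cases k)
    case 0
    then show ?thesis by (auto intro!: continuous_intros)
  next
    case (Suc m)
    have "(\<lambda>x. c + a \<bullet> x) differentiable_on U"
      unfolding differentiable_on_def differentiable_def
      using has_derivative_affine has_derivative_at_withinI by fast
    then show ?thesis using Suc by (simp add: partial_deriv_affine const)
  qed
  then show ?thesis by (simp add: smooth_on_def)
qed

definition sign_vector :: "real ^ 'n \<Rightarrow> bool" where
  "sign_vector \<epsilon> \<longleftrightarrow> (\<forall>i. \<epsilon> $ i \<in> {-1, 1})"

definition lattice_hyperplanes :: "real ^ 'n \<Rightarrow> (real ^ 'n) set" where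
  "lattice_hyperplanes \<epsilon> = {x. \<epsilon> \<bullet> x \<in> \<int>}"

lemma sign_vector_norm:
  assumes "sign_vector (\<epsilon> :: real ^ 'n)"
  shows "\<epsilon> \<bullet> \<epsilon> = real CARD('n)" "norm \<epsilon> = sqrt (real CARD('n))"
proof -
  have "\<epsilon> $ i * \<epsilon> $ i = 1" for i using assms by (auto simp: sign_vector_def dest!: spec[of _ i])
  then show "\<epsilon> \<bullet> \<epsilon> = real CARD('n)" by (simp add: inner_vec_def)
  then show "norm \<epsilon> = sqrt (real CARD('n))" by (simp add: norm_eq_sqrt_inner)
qed

lemma sign_vector_square: "sign_vector \<epsilon> \<Longrightarrow> \<epsilon> $ i * \<epsilon> $ i = 1"
  by (auto simp: sign_vector_def dest!: spec[of _ i])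

lemma sin_pi_eq_0_iff: "sin (pi * t) = 0 \<longleftrightarrow> t \<in> \<int>"
proof -
  have "sin (pi * t) = 0 \<longleftrightarrow> (\<exists>m::int. pi * t = of_int m * pi)" by (rule sin_zero_iff_int2)
  also have "\<dots> \<longleftrightarrow> t \<in> \<int>" by (auto simp: Ints_def mult.commute)
  finally show ?thesis .
qed

text \<open>
  At a zero of \<open>sin (\<pi> (\<epsilon> \<bullet> x))\<close> the function takes both signs along \<open>x \<plusminus> t \<epsilon>\<close>, so no zero is
  an interior point.
\<close>

lemma frontier_half_space:
  fixes \<epsilon> :: "real ^ 'n"
  assumes \<epsilon>: "sign_vector \<epsilon>"
  shows "frontier {x. sin (pi * (\<epsilon> \<bullet> x)) \<ge> 0} = lattice_hyperplanes \<epsilon>"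
proof -
  let ?h = "\<lambda>x. sin (pi * (\<epsilon> \<bullet> x))"
  let ?B = "{x. ?h x \<ge> 0}"
  let ?n = "real CARD('n)"
  have "closed ?B" by (intro closed_Collect_le continuous_intros)
  then have fr: "frontier ?B = ?B - interior ?B" by (simp add: frontier_def)
  have pos: "x \<in> interior ?B" if "?h x > 0" for x
  proof (rule interiorI)
    show "open {x. ?h x > 0}" by (intro open_Collect_less continuous_intros)
  qed (use that in auto)
  have zero: "x \<notin> interior ?B" if h0: "?h x = 0" for x
  proof
    assume x: "x \<in> interior ?B"
    have "isCont (\<lambda>t. x + t *\<^sub>R \<epsilon>) 0" "isCont (\<lambda>t. x - t *\<^sub>R \<epsilon>) 0" by (auto intro!: continuous_intros)
    then have "((\<lambda>t. x + t *\<^sub>R \<epsilon>) \<longlongrightarrow> x) (at_right 0)" "((\<lambda>t. x - t *\<^sub>R \<epsilon>) \<longlongrightarrow> x) (at_right 0)"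
      by (auto simp: isCont_def intro: filterlim_mono[OF _ order_refl at_le])
    then have "\<forall>\<^sub>F t in at_right 0. x + t *\<^sub>R \<epsilon> \<in> interior ?B" "\<forall>\<^sub>F t in at_right 0. x - t *\<^sub>R \<epsilon> \<in> interior ?B"
      using x open_interior topological_tendstoD by blast+
    moreover have "\<forall>\<^sub>F t in at_right 0. t < 1 / ?n" "\<forall>\<^sub>F t in at_right (0::real). 0 < t"
      by (auto simp: eventually_at_right_less intro!: eventually_at_rightI[of 0 "1 / ?n"])
    ultimately have "\<forall>\<^sub>F t in at_right (0::real). False"
    proof eventually_elim
      case (elim t)
      then have nn: "?h (x + t *\<^sub>R \<epsilon>) \<ge> 0" "?h (x - t *\<^sub>R \<epsilon>) \<ge> 0" using interior_subset by blast+
      have "pi * (\<epsilon> \<bullet> (x + t *\<^sub>R \<epsilon>)) = pi * (\<epsilon> \<bullet> x) + pi * (t * ?n)"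
        "pi * (\<epsilon> \<bullet> (x - t *\<^sub>R \<epsilon>)) = pi * (\<epsilon> \<bullet> x) - pi * (t * ?n)"
        using sign_vector_norm(1)[OF \<epsilon>] by (simp_all add: inner_add_right inner_diff_right algebra_simps)
      then have h: "?h (x + t *\<^sub>R \<epsilon>) = cos (pi * (\<epsilon> \<bullet> x)) * sin (pi * (t * ?n))"
        "?h (x - t *\<^sub>R \<epsilon>) = - (cos (pi * (\<epsilon> \<bullet> x)) * sin (pi * (t * ?n)))"
        using h0 by (simp_all add: sin_add sin_diff)
      have "cos (pi * (\<epsilon> \<bullet> x)) \<noteq> 0"
        using sin_cos_squared_add[of "pi * (\<epsilon> \<bullet> x)"] h0 by auto
      moreover have "sin (pi * (t * ?n)) > 0"
        using elim by (intro sin_gt_zero) (auto simp: field_simps)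
      ultimately show False using nn unfolding h by (auto simp: zero_le_mult_iff mult_le_0_iff)
    qed
    then show False by simp
  qed
  have "x \<in> frontier ?B \<longleftrightarrow> ?h x = 0" for x
    unfolding fr using pos[of x] zero[of x] by (auto simp: less_le)
  then show ?thesis by (auto simp: lattice_hyperplanes_def sin_pi_eq_0_iff)
qed

lemma closed_lattice_hyperplanes: "sign_vector \<epsilon> \<Longrightarrow> closed (lattice_hyperplanes \<epsilon>)"
  using frontier_closed[of "{x. sin (pi * (\<epsilon> \<bullet> x)) \<ge> 0}"] by (simp add: frontier_half_space)

text \<open>
  The hyperplane \<open>\<epsilon> \<bullet> x = m\<close> solved for \<open>x\<^sub>i\<close>: since \<open>(\<epsilon>\<^sub>i)\<^sup>2 = 1\<close>, the solution is
  \<open>x\<^sub>i = \<epsilon>\<^sub>i m - (\<Sum>k\<noteq>i. \<epsilon>\<^sub>i \<epsilon>\<^sub>k x\<^sub>k)\<close>, whose gradient is this vector.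
\<close>

definition hyperplane_slope :: "'n \<Rightarrow> real ^ 'n \<Rightarrow> real ^ 'n" where
  "hyperplane_slope i \<epsilon> = axis i 1 - \<epsilon> $ i *\<^sub>R \<epsilon>"

definition hyperplane_graph :: "'n \<Rightarrow> real ^ 'n \<Rightarrow> int \<Rightarrow> real ^ 'n \<Rightarrow> real" where
  "hyperplane_graph i \<epsilon> m x = \<epsilon> $ i * of_int m + hyperplane_slope i \<epsilon> \<bullet> x"

lemma hyperplane_graph_eq: "hyperplane_graph i \<epsilon> m x = x $ i + \<epsilon> $ i * (of_int m - \<epsilon> \<bullet> x)"
  by (simp add: hyperplane_graph_def hyperplane_slope_def inner_diff_left inner_axis' algebra_simps)

lemma graph_chart_hyperplane:
  fixes \<epsilon> :: "real ^ 'n"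
  assumes \<epsilon>: "sign_vector \<epsilon>"
  shows "graph_chart (lattice_hyperplanes \<epsilon>) i {x. \<bar>\<epsilon> \<bullet> x - of_int m\<bar> < 1} (hyperplane_graph i \<epsilon> m)"
  unfolding graph_chart_def
proof (intro conjI ballI allI)
  show "open {x. \<bar>\<epsilon> \<bullet> x - of_int m\<bar> < 1}"
    by (intro open_Collect_less continuous_intros)
  show "smooth_on (hyperplane_graph i \<epsilon> m) (cylinder i {x. \<bar>\<epsilon> \<bullet> x - of_int m\<bar> < 1})"
    unfolding hyperplane_graph_def[abs_def] by (rule smooth_on_affine)
  show "hyperplane_graph i \<epsilon> m (set_coord i t x) = hyperplane_graph i \<epsilon> m x" for t x
    using sign_vector_square[OF \<epsilon>, of i]
    by (simp add: hyperplane_graph_def hyperplane_slope_def set_coord_eq inner_add_right inner_diff_left inner_axis)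
  have "\<epsilon> \<bullet> x \<in> \<int> \<longleftrightarrow> x $ i = hyperplane_graph i \<epsilon> m x" if "\<bar>\<epsilon> \<bullet> x - of_int m\<bar> < 1" for x
  proof -
    have "\<epsilon> \<bullet> x \<in> \<int> \<longleftrightarrow> \<epsilon> \<bullet> x = of_int m"
    proof
      assume "\<epsilon> \<bullet> x \<in> \<int>"
      then obtain l where l: "\<epsilon> \<bullet> x = of_int l" by (auto elim: Ints_cases)
      with that have "l = m" by linarith
      with l show "\<epsilon> \<bullet> x = of_int m" by simp
    qed simp
    also have "\<dots> \<longleftrightarrow> x $ i = hyperplane_graph i \<epsilon> m x"
      using sign_vector_square[OF \<epsilon>, of i] by (auto simp: hyperplane_graph_eq)
    finally show ?thesis .
  qed
  then show "lattice_hyperplanes \<epsilon> \<inter> {x. \<bar>\<epsilon> \<bullet> x - of_int m\<bar> < 1}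
      = {x \<in> {x. \<bar>\<epsilon> \<bullet> x - of_int m\<bar> < 1}. x $ i = hyperplane_graph i \<epsilon> m x}"
    by (auto simp: lattice_hyperplanes_def)
qed

lemma chart_normal_hyperplane: "chart_normal i (hyperplane_graph i \<epsilon> m) x = \<epsilon> $ i *\<^sub>R \<epsilon>"
  by (simp add: chart_normal_def hyperplane_graph_def[abs_def] partial_deriv_affine hyperplane_slope_def vec_eq_iff)

lemma norm_chart_normal_hyperplane:
  fixes \<epsilon> :: "real ^ 'n"
  assumes "sign_vector \<epsilon>"
  shows "norm (chart_normal i (hyperplane_graph i \<epsilon> m) x) = sqrt (real CARD('n))"
proof -
  have "\<bar>\<epsilon> $ i\<bar> = 1" using assms by (auto simp: sign_vector_def dest!: spec[of _ i])
  then show ?thesis by (simp add: chart_normal_hyperplane sign_vector_norm(2)[OF assms])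
qed

lemma smooth_hypersurface_lattice_hyperplanes:
  assumes "sign_vector \<epsilon>"
  shows "smooth_hypersurface (lattice_hyperplanes \<epsilon>)"
  unfolding smooth_hypersurface_def
proof
  fix x assume "x \<in> lattice_hyperplanes \<epsilon>"
  then obtain m where "\<epsilon> \<bullet> x = of_int m" by (auto simp: lattice_hyperplanes_def elim: Ints_cases)
  then have "x \<in> {x. \<bar>\<epsilon> \<bullet> x - of_int m\<bar> < 1}" by simp
  then show "\<exists>i U g. x \<in> U \<and> graph_chart (lattice_hyperplanes \<epsilon>) i U g"
    by (intro exI conjI) (assumption, rule graph_chart_hyperplane[OF assms, of undefined m])
qed

lemma l1_norm_unit_normal_hyperplane:
  fixes \<epsilon> :: "real ^ 'n"
  assumes \<epsilon>: "sign_vector \<epsilon>" and p: "p \<in> lattice_hyperplanes \<epsilon>"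
    and v: "is_unit_normal (lattice_hyperplanes \<epsilon>) p v"
  shows "l1_norm v = sqrt (real CARD('n))"
proof -
  obtain m where m: "\<epsilon> \<bullet> p = of_int m" using p by (auto simp: lattice_hyperplanes_def elim: Ints_cases)
  have pU: "p \<in> {x. \<bar>\<epsilon> \<bullet> x - of_int m\<bar> < 1}" using m by simp
  have "\<bar>\<epsilon> $ k\<bar> = 1" for k using \<epsilon> by (auto simp: sign_vector_def dest!: spec[of _ k])
  then have "sqrt (real CARD('n)) * \<bar>v $ k\<bar> = 1" for k
    using unit_normal_component[OF graph_chart_hyperplane[OF \<epsilon>, of undefined m] p pU v, of k]
    by (simp add: chart_normal_hyperplane abs_mult sign_vector_norm(2)[OF \<epsilon>])
  then have "\<bar>v $ k\<bar> = 1 / sqrt (real CARD('n))" for k by (simp add: field_simps)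
  then show ?thesis by (simp add: l1_norm_def real_div_sqrt)
qed

lemma negligible_lattice_hyperplanes:
  assumes "sign_vector \<epsilon>"
  shows "negligible (lattice_hyperplanes \<epsilon>)"
proof -
  have "\<epsilon> \<noteq> 0" using sign_vector_norm(2)[OF assms] by auto
  then have "negligible {x. \<epsilon> \<bullet> x = b}" for b by (intro negligible_hyperplane) auto
  then have "negligible (\<Union>m\<in>\<int>. {x. \<epsilon> \<bullet> x = m})"
    by (intro negligible_countable_Union) (auto simp: countable_int)
  moreover have "lattice_hyperplanes \<epsilon> = (\<Union>m\<in>\<int>. {x. \<epsilon> \<bullet> x = m})"
    by (auto simp: lattice_hyperplanes_def)
  ultimately show ?thesis by simp
qed

lemma periodic_half_space_is_periodic:
  fixes \<epsilon> :: "real ^ 'n"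
  assumes \<epsilon>: "sign_vector \<epsilon>"
  shows "periodic_set {x. sin (pi * (\<epsilon> \<bullet> x)) \<ge> 0}"
  unfolding periodic_set_def
proof (intro conjI allI)
  let ?h = "\<lambda>x. sin (pi * (\<epsilon> \<bullet> x))"
  have Z: "x \<in> lattice_hyperplanes \<epsilon> \<longleftrightarrow> ?h x = 0" for x
    by (simp add: lattice_hyperplanes_def sin_pi_eq_0_iff)
  fix i
  have "?h (x - axis i 1) = - ?h x" for x
  proof -
    have "\<epsilon> $ i = -1 \<or> \<epsilon> $ i = 1" using \<epsilon> by (auto simp: sign_vector_def)
    then have "cos (pi * \<epsilon> $ i) = -1" "sin (pi * \<epsilon> $ i) = 0" by auto
    then show ?thesis by (simp add: inner_diff_right inner_axis right_diff_distrib sin_diff)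
  qed
  moreover have "y \<in> (\<lambda>x. x + axis i 1) ` {x. ?h x \<ge> 0} \<longleftrightarrow> ?h (y - axis i 1) \<ge> 0" for y
    by (auto simp: image_iff intro!: exI[of _ "y - axis i 1"])
  ultimately have im: "(\<lambda>x. x + axis i 1) ` {x. ?h x \<ge> 0} = {x. ?h x \<le> 0}" by auto
  have "sym_diff ((\<lambda>x. x + axis i 1) ` {x. ?h x \<ge> 0}) (- {x. ?h x \<ge> 0}) \<subseteq> lattice_hyperplanes \<epsilon>"
    unfolding im by (auto simp: Z)
  then show "negligible (sym_diff ((\<lambda>x. x + axis i 1) ` {x. ?h x \<ge> 0}) (- {x. ?h x \<ge> 0}))"
    by (rule negligible_subset[OF negligible_lattice_hyperplanes[OF \<epsilon>]])
next
  let ?h = "\<lambda>x. sin (pi * (\<epsilon> \<bullet> x))"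
  have Z: "x \<in> lattice_hyperplanes \<epsilon> \<longleftrightarrow> ?h x = 0" for x
    by (simp add: lattice_hyperplanes_def sin_pi_eq_0_iff)
  have im: "uminus ` {x. ?h x \<ge> 0} = {x. ?h x \<le> 0}"
    by (auto simp: image_iff intro!: exI[of _ "- y" for y])
  have "sym_diff (uminus ` {x. ?h x \<ge> 0}) (- {x. ?h x \<ge> 0}) \<subseteq> lattice_hyperplanes \<epsilon>"
    unfolding im by (auto simp: Z)
  then show "negligible (sym_diff (uminus ` {x. ?h x \<ge> 0}) (- {x. ?h x \<ge> 0}))"
    by (rule negligible_subset[OF negligible_lattice_hyperplanes[OF \<epsilon>]])
qed

text \<open>
  All hyperplanes \<open>\<epsilon> \<bullet> x = m\<close> are graphs over the same coordinate \<open>i\<close> with area element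
  \<open>sqrt n\<close>, and their heights over a parameter point differ by integers. So, apart from the null set
  where some height is \<open>1/2\<close>, at most one of them passes through the cube above a given point of its shadow,
  which has measure \<open>1\<close>.
\<close>

lemma measure_lattice_hyperplanes_le:
  fixes \<epsilon> :: "real ^ 'n"
  assumes \<epsilon>: "sign_vector \<epsilon>"
  shows "measure (surface_measure (lattice_hyperplanes \<epsilon>)) (unit_cube \<inter> lattice_hyperplanes \<epsilon>) \<le> sqrt (real CARD('n))"
proof -
  let ?S = "lattice_hyperplanes \<epsilon>"
  let ?M = "surface_measure ?S"
  let ?n = "real CARD('n)"
  \<comment> \<open>Any coordinate will do.\<close>
  define i :: 'n where "i = undefined"
  define g where "g = hyperplane_graph i \<epsilon>"
  note S = closed_lattice_hyperplanes[OF \<epsilon>] smooth_hypersurface_lattice_hyperplanes[OF \<epsilon>]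
  note sM = sets_surface_measure[OF S]
  note ch = graph_chart_hyperplane[OF \<epsilon>, of i, folded g_def]
  define A where "A m = unit_cube \<inter> {x. \<epsilon> \<bullet> x = of_int m}" for m :: int
  have A: "A m \<in> sets borel" "A m \<subseteq> ?S \<inter> {x. \<bar>\<epsilon> \<bullet> x - of_int m\<bar> < 1}" for m
  proof -
    have "closed (A m)" unfolding A_def
      by (intro closed_Int compact_imp_closed[OF compact_unit_cube] closed_Collect_eq continuous_intros)
    then show "A m \<in> sets borel" by simp
    show "A m \<subseteq> ?S \<inter> {x. \<bar>\<epsilon> \<bullet> x - of_int m\<bar> < 1}" by (auto simp: A_def lattice_hyperplanes_def)
  qed
  define E where "E m = {x. set_coord i (g m x) x \<in> A m} \<inter> slab i" for m
  have E: "E m \<in> sets borel" for m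
    unfolding E_def using A[of m] by (intro sets.Int chart_lift_vimage[OF ch[of m]]) auto
  \<comment> \<open>The top face of the cube is discarded, since two consecutive hyperplanes may meet both faces.\<close>
  define Z where "Z m = {x. g m x = 1/2}" for m
  have Z: "Z m \<in> null_sets lborel" for m
  proof -
    let ?b = "1/2 - \<epsilon> $ i * of_int m"
    have "\<epsilon> $ i = 1 \<or> \<epsilon> $ i = -1" using \<epsilon> by (auto simp: sign_vector_def)
    then have "?b \<noteq> 0"
    proof
      assume "\<epsilon> $ i = 1"
      moreover have "(1::real) \<noteq> 2 * of_int m" by (metis (mono_tags) dvd_triv_left odd_one of_int_1 of_int_eq_iff of_int_mult of_int_numeral)
      ultimately show ?thesis by simp
    next
      assume "\<epsilon> $ i = -1"
      moreover have "(1::real) \<noteq> 2 * of_int (- m)" by (metis (mono_tags) dvd_triv_left odd_one of_int_1 of_int_eq_iff of_int_mult of_int_numeral)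
      ultimately show ?thesis by simp
    qed
    moreover have "Z m = {x. hyperplane_slope i \<epsilon> \<bullet> x = ?b}"
      by (auto simp: Z_def g_def hyperplane_graph_def)
    ultimately have "negligible (Z m)" "closed (Z m)"
      by (auto intro!: negligible_hyperplane closed_Collect_eq continuous_intros)
    then show ?thesis
      by (auto simp: negligible_iff_null_sets null_sets_completion_iff)
  qed
  have emA: "emeasure ?M (A m) = ennreal (sqrt ?n) * emeasure lborel (E m - Z m)" for m
  proof -
    have "emeasure ?M (A m) = chart_integral i (g m) (A m) (area_element i (g m))"
      by (rule emeasure_surface_measure[OF S ch A])
    also have "\<dots> = (\<integral>\<^sup>+x. ennreal (sqrt ?n) * indicator (E m) x \<partial>lborel)"
      unfolding chart_integral_def g_def norm_chart_normal_hyperplane[OF \<epsilon>]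
      by (intro nn_integral_cong) (auto simp: E_def g_def indicator_def)
    also have "\<dots> = ennreal (sqrt ?n) * emeasure lborel (E m)"
      using E by (simp add: nn_integral_cmult)
    also have "emeasure lborel (E m) = emeasure lborel (E m - Z m)"
      using E Z by (intro emeasure_Diff_null_set[symmetric]) auto
    finally show ?thesis .
  qed
  have gE: "-1/2 \<le> g m x" "g m x < 1/2" "x \<in> shadow_cube i" if "x \<in> E m - Z m" for m x
  proof -
    have x: "set_coord i (g m x) x \<in> unit_cube" "x \<in> slab i" "g m x \<noteq> 1/2"
      using that by (auto simp: E_def A_def Z_def)
    then have c: "set_coord i (g m x) x $ k \<in> {-1/2..1/2}" for k unfolding unit_cube_def by blast
    show "-1/2 \<le> g m x" "g m x < 1/2" using c[of i] x(3) by auto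
    have "x $ k \<in> {-1/2..1/2}" if "k \<noteq> i" for k using c[of k] that by simp
    then show "x \<in> shadow_cube i" using x(2) by (auto simp: shadow_cube_def)
  qed
  have disj: "m = l" if "x \<in> E m - Z m" "x \<in> E l - Z l" for m l x
  proof -
    have "g m x - g l x = \<epsilon> $ i * (of_int m - of_int l)"
      by (simp add: g_def hyperplane_graph_eq algebra_simps)
    moreover have "\<bar>\<epsilon> $ i\<bar> = 1" using \<epsilon> by (auto simp: sign_vector_def dest!: spec[of _ i])
    ultimately have "\<bar>g m x - g l x\<bar> = \<bar>of_int m - of_int l\<bar>" by (simp add: abs_mult)
    moreover have "\<bar>g m x - g l x\<bar> < 1" using gE(1,2)[OF that(1)] gE(1,2)[OF that(2)] by linarith
    ultimately show "m = l" by linarith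
  qed
  have "unit_cube \<inter> ?S = (\<Union>k. A (int_decode k))"
  proof -
    have "x \<in> (\<Union>k. A (int_decode k))" if "x \<in> unit_cube" "x \<in> ?S" for x
    proof -
      have "\<epsilon> \<bullet> x \<in> \<int>" using that by (simp add: lattice_hyperplanes_def)
      then obtain m where "\<epsilon> \<bullet> x = of_int m" by (rule Ints_cases)
      then have "x \<in> A (int_decode (int_encode m))" using that by (simp add: A_def)
      then show ?thesis by blast
    qed
    then show ?thesis by (auto simp: A_def lattice_hyperplanes_def)
  qed
  then have "emeasure ?M (unit_cube \<inter> ?S) = emeasure ?M (\<Union>k. A (int_decode k))" by simp
  also have "\<dots> \<le> (\<Sum>k. emeasure ?M (A (int_decode k)))"
    using A(1) by (intro emeasure_subadditive_countably) (auto simp: sM)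
  also have "\<dots> = ennreal (sqrt ?n) * (\<Sum>k. emeasure lborel (E (int_decode k) - Z (int_decode k)))"
    by (simp add: emA)
  also have "(\<Sum>k. emeasure lborel (E (int_decode k) - Z (int_decode k)))
      = emeasure lborel (\<Union>k. E (int_decode k) - Z (int_decode k))"
  proof (rule suminf_emeasure)
    show "range (\<lambda>k. E (int_decode k) - Z (int_decode k)) \<subseteq> sets lborel"
      using E null_setsD2[OF Z] by (auto intro!: sets.Diff)
    show "disjoint_family (\<lambda>k. E (int_decode k) - Z (int_decode k))"
      unfolding disjoint_family_on_def
    proof (intro ballI impI)
      fix k l :: nat assume "k \<noteq> l"
      then have "int_decode k \<noteq> int_decode l" by (metis int_decode_inverse)
      then show "(E (int_decode k) - Z (int_decode k)) \<inter> (E (int_decode l) - Z (int_decode l)) = {}"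
        using disj by blast
    qed
  qed
  also have "ennreal (sqrt ?n) * emeasure lborel (\<Union>k. E (int_decode k) - Z (int_decode k))
      \<le> ennreal (sqrt ?n) * emeasure lborel (shadow_cube i)"
    using gE(3) sets_shadow_cube by (intro mult_left_mono emeasure_mono) auto
  also have "\<dots> = ennreal (sqrt ?n)" by (simp add: emeasure_shadow_cube)
  finally show ?thesis
    by (simp add: measure_def enn2real_leI)
qed

theorem mainTheorem4:
  fixes \<Omega> B :: "(real ^ 'n) set"
  assumes "periodic_set \<Omega>"
    and "smooth_hypersurface (frontier \<Omega>)"
    and "periodic_half_space B"
  shows "cube_surface_integral (frontier \<Omega>) (\<lambda>x. 1) \<ge>
           cube_surface_integral (frontier B) (\<lambda>x. 1) +
           cube_surface_integral (frontier \<Omega>)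
             (\<lambda>x. 1 - l1_norm (exterior_normal \<Omega> x) / sqrt (real CARD('n))) \<and>
         (\<exists>\<Omega>' :: (real ^ 'n) set.
           periodic_set \<Omega>' \<and> smooth_hypersurface (frontier \<Omega>') \<and>
           cube_surface_integral (frontier \<Omega>') (\<lambda>x. 1) =
             cube_surface_integral (frontier B) (\<lambda>x. 1) +
             cube_surface_integral (frontier \<Omega>')
               (\<lambda>x. 1 - l1_norm (exterior_normal \<Omega>' x) / sqrt (real CARD('n))))"
proof -
  let ?n = "real CARD('n)"
  obtain \<epsilon> :: "real ^ 'n" where \<epsilon>: "sign_vector \<epsilon>" and B: "B = {x. sin (pi * (\<epsilon> \<bullet> x)) \<ge> 0}"
    using assms(3) unfolding periodic_half_space_def sign_vector_def inner_vec_def by auto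
  have fB: "frontier B = lattice_hyperplanes \<epsilon>" unfolding B by (rule frontier_half_space[OF \<epsilon>])
  have sB: "smooth_hypersurface (frontier B)"
    unfolding fB by (rule smooth_hypersurface_lattice_hyperplanes[OF \<epsilon>])
  have "cube_surface_integral (frontier B) (\<lambda>x. 1) \<le> sqrt ?n"
    using cube_surface_integral_1[OF frontier_closed sB] measure_lattice_hyperplanes_le[OF \<epsilon>] by (simp add: fB)
  moreover have "cube_surface_integral (frontier \<Omega>) (\<lambda>x. 1) \<ge> sqrt ?n +
      cube_surface_integral (frontier \<Omega>) (\<lambda>x. 1 - l1_norm (exterior_normal \<Omega> x) / sqrt ?n)"
    by (intro cube_surface_integral_ge frontier_closed assms(2)
        is_unit_normal_exterior_normal unit_segment_meets_frontier assms(1))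
  moreover have "periodic_set B" unfolding B by (rule periodic_half_space_is_periodic[OF \<epsilon>])
  moreover have "cube_surface_integral (frontier B) (\<lambda>x. 1 - l1_norm (exterior_normal B x) / sqrt ?n) = 0"
  proof -
    have "l1_norm (exterior_normal B x) = sqrt ?n" if "x \<in> frontier B" for x
      using l1_norm_unit_normal_hyperplane[OF \<epsilon>] is_unit_normal_exterior_normal[OF sB that] that
      unfolding fB by blast
    then have zero: "indicator (unit_cube \<inter> frontier B) x *\<^sub>R (1 - l1_norm (exterior_normal B x) / sqrt ?n) = 0" for x
      by (auto simp: indicator_def)
    then show ?thesis
      unfolding cube_surface_integral_def set_lebesgue_integral_def zero by simp
  qed
  ultimately show ?thesis using sB by (intro conjI exI[of _ B]) auto
qed

end
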